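(* Let $p$ be a prime, let $(\alpha_j,\delta_j)\in\mathbb{C}_p\times(\mathbb{Q}\cup\{\infty\})$, $j=1,\dots,m$, be admissible pairs, and suppose $R=\bigcap_{j=1}^m\mathbb{Z}_{(p),\alpha_j,\delta_j}\cap\mathbb{Q}[X]$ is a Krull domain. Let $q\in\mathbb{Q}[X]$ be irreducible and $Q=q\mathbb{Q}[X]\cap R$. Then $Q$ is a maximal ideal of $R$ if and only if $q$ has no root in $\bigcup_{j=1}^m\bar B_p(\alpha_j,\delta_j)$.
   Context: Fix a prime $p$. $\overline{\mathbb{Q}_p}$ is an algebraic closure of $\mathbb{Q}_p$, $v_p$ the unique extension of the $p$-adic valuation, $\mathbb{C}_p$ the completion of $\overline{\mathbb{Q}_p}$. A pair $(\alpha,\delta)\in\mathbb{C}_p\times(\mathbb{Q}\cup\{\infty\})$ is admissible if: when $\delta\in\mathbb{Q}$, $\alpha\in\overline{\mathbb{Q}_p}$; when $\delta=\infty$, $\alpha$ is transcendental over $\mathbb{Q}$. For $\delta\in\mathbb{Q}$, $v_{p,\alpha,\delta}$ is the monomial valuation on $\mathbb{C}_p(X)$ given on polynomials by $v_{p,\alpha,\delta}(\sum_i a_i(X-\alpha)^i)=\min_i\{v_p(a_i)+i\delta\}$; for $\delta=\infty$, $v_{p,\alpha,\infty}(\varphi)=v_p(\varphi(\alpha))$ for $\varphi\in\mathbb{Q}(X)$. $\mathbb{Z}_{(p),\alpha,\delta}=\{\varphi\in\mathbb{Q}(X):v_{p,\alpha,\delta}(\varphi)\ge0\}$. $\bar B_p(\alpha,\delta)=\{x\in\mathbb{C}_p:v_p(x-\alpha)\ge\delta\}$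 (equal to $\{\alpha\}$ if $\delta=\infty$). Roots of $q$ are taken in $\mathbb{C}_p$. *)

theory Defs
  imports "HOL-Computational_Algebra.Polynomial" "HOL-Computational_Algebra.Fraction_Field"
    "HOL-Computational_Algebra.Factorial_Ring" "HOL-Library.Extended_Real"
begin

definition padic_val_rat :: "nat \<Rightarrow> rat \<Rightarrow> int" where
  "padic_val_rat p r = (case quotient_of r of (a, b) \<Rightarrow>
      int (multiplicity (int p) a) - int (multiplicity (int p) b))"

text \<open>Characterisation of (a copy of) C_p: a field K of characteristic 0 with a valuation
  v (values in the extended reals, v x = \<infinity> iff x = 0) extending the p-adic valuation of Q,
  algebraically closed, complete, and such that the algebraic closure of Q in K is dense.
  These properties determine C_p up to isometric isomorphism.\<close>
definition is_Cp :: "nat \<Rightarrow> ('k::field_char_0 \<Rightarrow> ereal) \<Rightarrow> bool" where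
  "is_Cp p v \<longleftrightarrow>
     (\<forall>x. v x = \<infinity> \<longleftrightarrow> x = 0) \<and>
     (\<forall>x. v x \<noteq> -\<infinity>) \<and>
     (\<forall>x y. v (x * y) = v x + v y) \<and>
     (\<forall>x y. v (x + y) \<ge> min (v x) (v y)) \<and>
     (\<forall>r. r \<noteq> 0 \<longrightarrow> v (of_rat r) = ereal (of_int (padic_val_rat p r))) \<and>
     (\<forall>P :: 'k poly. degree P > 0 \<longrightarrow> (\<exists>x. poly P x = 0)) \<and>
     (\<forall>s :: nat \<Rightarrow> 'k. (\<forall>M::real. \<exists>N. \<forall>m\<ge>N. \<forall>n\<ge>N. v (s m - s n) \<ge> ereal M) \<longrightarrow>
        (\<exists>L. \<forall>M::real. \<exists>N. \<forall>n\<ge>N. v (s n - L) \<ge> ereal M)) \<and>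
     (\<forall>x. \<forall>M::real. \<exists>y. (\<exists>P :: rat poly. P \<noteq> 0 \<and> poly (map_poly of_rat P) y = 0)
          \<and> v (x - y) \<ge> ereal M)"

definition Qp_in :: "('k::field_char_0 \<Rightarrow> ereal) \<Rightarrow> 'k set" where
  "Qp_in v = {x. \<forall>M::real. \<exists>r::rat. v (x - of_rat r) \<ge> ereal M}"

definition Qp_bar_in :: "('k::field_char_0 \<Rightarrow> ereal) \<Rightarrow> 'k set" where
  "Qp_bar_in v = {x. \<exists>P :: 'k poly. P \<noteq> 0 \<and> (\<forall>i. coeff P i \<in> Qp_in v) \<and> poly P x = 0}"

definition transcendental_over_Q :: "'k::field_char_0 \<Rightarrow> bool" where
  "transcendental_over_Q x \<longleftrightarrow> \<not> (\<exists>P :: rat poly. P \<noteq> 0 \<and> poly (map_poly of_rat P) x = 0)"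

text \<open>Admissible pairs; \<delta> = None stands for \<delta> = \<infinity>.\<close>
definition admissible :: "('k::field_char_0 \<Rightarrow> ereal) \<Rightarrow> 'k \<Rightarrow> rat option \<Rightarrow> bool" where
  "admissible v \<alpha> \<delta> = (case \<delta> of Some _ \<Rightarrow> \<alpha> \<in> Qp_bar_in v | None \<Rightarrow> transcendental_over_Q \<alpha>)"

text \<open>v_{p,\<alpha>,\<delta>} on polynomials in Q[X] (enough, as R is contained in Q[X]).\<close>
definition val_pol :: "('k::field_char_0 \<Rightarrow> ereal) \<Rightarrow> 'k \<Rightarrow> rat option \<Rightarrow> rat poly \<Rightarrow> ereal" where
  "val_pol v \<alpha> \<delta> f = (case \<delta> of
     None \<Rightarrow> v (poly (map_poly of_rat f) \<alpha>)
   | Some d \<Rightarrow> Min ((\<lambda>i. v (coeff (pcompose (map_poly of_rat f) [:\<alpha>, 1:]) i)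
                          + ereal (of_rat d * of_nat i)) ` {..degree f}))"

definition closed_ball_p :: "('k::field_char_0 \<Rightarrow> ereal) \<Rightarrow> 'k \<Rightarrow> rat option \<Rightarrow> 'k set" where
  "closed_ball_p v \<alpha> \<delta> = (case \<delta> of None \<Rightarrow> {\<alpha>}
      | Some d \<Rightarrow> {x. v (x - \<alpha>) \<ge> ereal (of_rat d)})"

definition frac_field_of :: "rat poly set \<Rightarrow> rat poly fract set" where
  "frac_field_of R = {Fract a b | a b. a \<in> R \<and> b \<in> R \<and> b \<noteq> 0}"

definition is_subring :: "'a::comm_ring_1 set \<Rightarrow> bool" where
  "is_subring R \<longleftrightarrow> 1 \<in> R \<and> (\<forall>x\<in>R. \<forall>y\<in>R. x - y \<in> R \<and> x * y \<in> R)"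

definition discrete_valuation_on :: "'f::field set \<Rightarrow> ('f \<Rightarrow> int) \<Rightarrow> bool" where
  "discrete_valuation_on K w \<longleftrightarrow>
     (\<forall>x\<in>K. \<forall>y\<in>K. x \<noteq> 0 \<longrightarrow> y \<noteq> 0 \<longrightarrow> w (x * y) = w x + w y) \<and>
     (\<forall>x\<in>K. \<forall>y\<in>K. x \<noteq> 0 \<longrightarrow> y \<noteq> 0 \<longrightarrow> x + y \<noteq> 0 \<longrightarrow> w (x + y) \<ge> min (w x) (w y)) \<and>
     w ` (K - {0}) = UNIV"

definition krull_domain :: "rat poly set \<Rightarrow> bool" where
  "krull_domain R \<longleftrightarrow> is_subring R \<and>
     (\<exists>W :: (rat poly fract \<Rightarrow> int) set.
        (\<forall>w\<in>W. discrete_valuation_on (frac_field_of R) w) \<and>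
        (\<lambda>f. Fract f 1) ` R = {x \<in> frac_field_of R. x = 0 \<or> (\<forall>w\<in>W. w x \<ge> 0)} \<and>
        (\<forall>x \<in> frac_field_of R. x \<noteq> 0 \<longrightarrow> finite {w\<in>W. w x \<noteq> 0}))"

definition is_ideal_in :: "'a::comm_ring_1 set \<Rightarrow> 'a set \<Rightarrow> bool" where
  "is_ideal_in R I \<longleftrightarrow> I \<subseteq> R \<and> 0 \<in> I \<and> (\<forall>x\<in>I. \<forall>y\<in>I. x - y \<in> I) \<and> (\<forall>r\<in>R. \<forall>x\<in>I. r * x \<in> I)"

definition maximal_ideal_in :: "'a::comm_ring_1 set \<Rightarrow> 'a set \<Rightarrow> bool" where
  "maximal_ideal_in R I \<longleftrightarrow> is_ideal_in R I \<and> I \<noteq> R \<and>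
     (\<forall>J. is_ideal_in R J \<and> I \<subseteq> J \<longrightarrow> J = I \<or> J = R)"

end

theory Submission
  imports Defs "HOL-Computational_Algebra.Field_as_Ring"
    "HOL-Computational_Algebra.Polynomial_Factorial"
begin

text \<open>Inverting \<open>p\<close> turns \<open>R\<close> into \<open>\<rat>[X]\<close>, so \<open>Q\<close> is maximal iff some \<open>g \<in> R\<close>
  satisfies \<open>p g \<equiv> 1\<close> modulo \<open>q\<close>. A root of \<open>q\<close> in one of the discs prevents this: elements of \<open>R\<close>
  have values of norm at most 1 on the discs, so those with value of norm less than 1 at the root
  form a proper ideal containing \<open>Q\<close> and \<open>p\<close>.

  Conversely, let \<open>\<xi>\<close> be a root outside all discs. Conjugates over the closure of \<open>\<rat>\<close> have equal
  absolute values, so a suitable product of powers of minimal polynomials of the centres is larger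
  at \<open>\<xi>\<close> than on every disc. Approximating its coefficients by rationals and rescaling by a power of
  \<open>p\<close> gives an element of \<open>R\<close> of norm greater than 1 at \<open>\<xi>\<close>, and then one element \<open>f \<in> R\<close> of norm
  greater than 1 at all roots. If \<open>h\<close> represents \<open>f\<close> to the power \<open>- n\<close> modulo \<open>q\<close>, then for large
  \<open>n\<close> it is small at the roots of \<open>q\<close>, hence has small coefficients, and \<open>g = h f\<^sup>n / p\<close> works.\<close>

section \<open>Real inequalities\<close>

text \<open>The witness must have rational coefficients although neither the centres nor the roots
  of \<open>q\<close> are rational. The constructions therefore run over the closure
  \<open>F\<close> of the rationals: its elements can be approximated by rationals, and conjugation
  over \<open>F\<close> carries an estimate from one root to its whole orbit. Since \<open>q\<close>
  may break into several orbits over \<open>F\<close>, each root first gets its own polynomial, and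
  these are merged afterwards. What is carried along is a strict gap between a bound
  \<open>t\<close> on all discs and the value at the root. Scaling by rationals moves norms only in
  steps of the factor \<open>exp 1\<close>, so a gap cannot be placed around 1 directly; a power
  widens it beyond that factor first. Inverting \<open>p\<close> modulo \<open>q\<close> costs the
  same factor once more, and it is paid for by making the inverse of a power of \<open>f\<close>
  small. Discs are measured by Taylor coefficients and not by values, because this is how membership
  in \<open>R\<close> is defined.\<close>

lemma finite_upper_bound:
  fixes u :: "'b \<Rightarrow> real"
  assumes "finite S"
  obtains M where "M \<ge> 1" "\<And>j. j \<in> S \<Longrightarrow> u j \<le> M"
  using that[of "Max (insert 1 (u ` S))"] assms by simp

lemma finite_pos_lower_bound:
  fixes u :: "'b \<Rightarrow> real"
  assumes "finite S" "\<And>j. j \<in> S \<Longrightarrow> u j > 0"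
  obtains e where "e > 0" "\<And>j. j \<in> S \<Longrightarrow> e < u j"
proof -
  have "e / 2 < u j" if "e = Min (insert 1 (u ` S))" "e > 0" "j \<in> S" for e j
  proof -
    have "e \<le> u j"
      using that(1,3) assms(1) by simp
    then show ?thesis
      using that(2) by linarith
  qed
  moreover have "Min (insert 1 (u ` S)) > 0"
    using assms by (subst Min_gr_iff) auto
  ultimately show ?thesis
    using that[of "Min (insert 1 (u ` S)) / 2"] by simp
qed

lemma power_eventually_gt:
  fixes x y :: real
  assumes "1 < x"
  shows "eventually (\<lambda>n. y < x ^ n) sequentially"
proof -
  obtain N where "y < x ^ N"
    using real_arch_pow[OF assms] by blast
  moreover have "x ^ N \<le> x ^ n" if "n \<ge> N" for n
    using assms that by (intro power_increasing) auto
  ultimately show ?thesis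
    unfolding eventually_sequentially by (meson less_le_trans)
qed

text \<open>The constant disappears on taking k-th roots: if \<open>y < x\<close>, the powers of
  \<open>x / y\<close> outgrow \<open>C\<close>. This turns the comparison of values at conjugates
  up to a constant into an exact inequality.\<close>

lemma power_le_const_mult_power_imp_le:
  fixes x y :: real
  assumes "x \<ge> 0" "y \<ge> 0" "\<And>k. x ^ k \<le> C * y ^ k"
  shows "x \<le> y"
proof (rule ccontr)
  assume "\<not> x \<le> y"
  then have xy: "y < x"
    by simp
  show False
  proof (cases "y = 0")
    case True
    then show False
      using assms(3)[of 1] xy by simp
  next
    case False
    then have y: "y > 0"
      using assms by simp
    obtain k where "C < (x / y) ^ k"
      using real_arch_pow[of "x / y" C] xy y by auto
    then have "C * y ^ k < x ^ k"
      using y by (simp add: power_divide field_simps)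
    then show False
      using assms(3)[of k] by linarith
  qed
qed

lemma prod_list_map_mono:
  fixes u w :: "'b \<Rightarrow> real"
  assumes "\<And>x. x \<in> set xs \<Longrightarrow> 0 \<le> u x \<and> u x \<le> w x"
  shows "0 \<le> (\<Prod>x\<leftarrow>xs. u x) \<and> (\<Prod>x\<leftarrow>xs. u x) \<le> (\<Prod>x\<leftarrow>xs. w x)"
  using assms by (induction xs) (auto intro!: mult_mono mult_nonneg_nonneg intro: order_trans)

lemma prod_list_map_pos:
  fixes u :: "'b \<Rightarrow> real"
  shows "(\<And>x. x \<in> set xs \<Longrightarrow> 0 < u x) \<Longrightarrow> 0 < (\<Prod>x\<leftarrow>xs. u x)"
  by (induction xs) auto

lemma prod_list_map_strict_mono:
  fixes u w :: "'b \<Rightarrow> real"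
  assumes "\<And>x. x \<in> set xs \<Longrightarrow> 0 < u x \<and> u x \<le> w x" "y \<in> set xs" "u y < w y"
  shows "(\<Prod>x\<leftarrow>xs. u x) < (\<Prod>x\<leftarrow>xs. w x)"
  using assms
proof (induction xs)
  case (Cons x xs)
  have pos: "0 < (\<Prod>x\<leftarrow>xs. u x)"
    using Cons.prems(1) by (intro prod_list_map_pos) simp
  have le: "(\<Prod>x\<leftarrow>xs. u x) \<le> (\<Prod>x\<leftarrow>xs. w x)"
    using prod_list_map_mono[of xs u w] Cons.prems(1) by (simp add: less_imp_le)
  have x: "0 < u x" "u x \<le> w x"
    using Cons.prems(1)[of x] by auto
  show ?case
  proof (cases "u x < w x")
    case True
    then have "u x * (\<Prod>x\<leftarrow>xs. u x) < w x * (\<Prod>x\<leftarrow>xs. u x)"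
      using pos by (rule mult_strict_right_mono)
    also have "\<dots> \<le> w x * (\<Prod>x\<leftarrow>xs. w x)"
      using le x by (intro mult_left_mono) auto
    finally show ?thesis
      by simp
  next
    case False
    then have "y \<in> set xs"
      using Cons.prems by auto
    then have "(\<Prod>x\<leftarrow>xs. u x) < (\<Prod>x\<leftarrow>xs. w x)"
      using Cons.IH Cons.prems by simp
    then have "u x * (\<Prod>x\<leftarrow>xs. u x) < u x * (\<Prod>x\<leftarrow>xs. w x)"
      using x by (intro mult_strict_left_mono)
    also have "\<dots> \<le> w x * (\<Prod>x\<leftarrow>xs. w x)"
      using le pos x by (intro mult_right_mono) auto
    finally show ?thesis
      by simp
  qed
qed simp

section \<open>Polynomials\<close>

lemma pcompose_pCons_shift:
  "pcompose (pCons a f) [:b, 1:] = [:a:] + [:b, 1:] * pcompose f [:b, 1:]"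
  for f :: "'a::comm_ring_1 poly"
  by (simp add: pcompose_pCons)

lemma coeff_linear_mult:
  "coeff ([:b, 1:] * f) i = b * coeff f i + (case i of 0 \<Rightarrow> 0 | Suc k \<Rightarrow> coeff f k)"
  for f :: "'a::comm_ring_1 poly"
  by (cases i) auto

abbreviation rat_to :: "rat poly \<Rightarrow> 'k::field_char_0 poly" where
  "rat_to \<equiv> map_poly of_rat"

lemma coeff_rat_to [simp]: "coeff (rat_to f) i = of_rat (coeff f i)"
  by (simp add: coeff_map_poly)

lemma degree_rat_to [simp]: "degree (rat_to f) = degree f"
  by (simp add: degree_map_poly)

lemma rat_to_eq_0_iff [simp]: "rat_to f = 0 \<longleftrightarrow> f = 0"
  by (auto simp: poly_eq_iff)

lemma rat_to_add: "rat_to (f + g) = rat_to f + rat_to g"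
  by (rule poly_eqI) (simp add: of_rat_add)

lemma rat_to_diff: "rat_to (f - g) = rat_to f - rat_to g"
  by (rule poly_eqI) (simp add: of_rat_diff)

lemma rat_to_mult: "rat_to (f * g) = rat_to f * rat_to g"
  by (rule poly_eqI) (simp add: coeff_mult of_rat_sum of_rat_mult)

lemma rat_to_power: "rat_to (f ^ n) = rat_to f ^ n"
  by (induction n) (simp_all add: rat_to_mult)

lemma rat_to_smult: "rat_to (smult c f) = smult (of_rat c) (rat_to f)"
  by (rule poly_eqI) (simp add: of_rat_mult)

lemma rat_to_pCons: "rat_to (pCons c f) = pCons (of_rat c) (rat_to f)"
  by (rule poly_eqI) (simp add: coeff_pCons split: nat.split)

lemma rat_to_pderiv: "rat_to (pderiv f) = pderiv (rat_to f)"
  by (rule poly_eqI) (simp add: coeff_pderiv of_rat_mult of_rat_add)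

lemma irreducible_bezout:
  fixes q f :: "rat poly"
  assumes "irreducible q" "\<not> q dvd f"
  obtains a b where "a * f + b * q = 1"
proof -
  have "coprime q f"
    using assms by (simp add: prime_elem_imp_coprime irreducible_imp_prime_elem_gcd)
  moreover obtain b a where "b * q + a * f = gcd q f"
    using bezout_coefficients_fst_snd by blast
  ultimately show ?thesis
    using that[of a b] by (simp add: add.commute)
qed

text \<open>Otherwise a Bezout identity for \<open>q\<close> and \<open>f\<close>, evaluated at the
  common root, would read 0 = 1.\<close>

lemma irreducible_common_root_imp_dvd:
  fixes q f :: "rat poly" and x :: "'k::field_char_0"
  assumes "irreducible q" "poly (rat_to q) x = 0" "poly (rat_to f) x = 0"
  shows "q dvd f"
proof (rule ccontr)
  assume "\<not> q dvd f"
  then obtain a b where "a * f + b * q = 1"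
    using irreducible_bezout assms(1) by blast
  then have "poly (rat_to (a * f + b * q)) x = poly 1 x"
    by simp
  then show False
    using assms by (simp add: rat_to_add rat_to_mult)
qed

lemma irreducible_degree_pos:
  fixes q :: "rat poly"
  assumes "irreducible q"
  shows "degree q > 0"
  using assms by (metis bot_nat_0.not_eq_extremum irreducible_def is_unit_iff_degree)

text \<open>Separability: a common root of \<open>q\<close> and its derivative would force \<open>q\<close> to divide the
  derivative, which has smaller degree and is nonzero in characteristic 0.\<close>
lemma irreducible_rsquarefree:
  fixes q :: "rat poly"
  assumes "irreducible q"
  shows "rsquarefree (rat_to q :: 'k::field_char_0 poly)"
  unfolding rsquarefree_roots
proof (intro allI notI)
  fix a :: 'k assume a: "poly (rat_to q) a = 0 \<and> poly (pderiv (rat_to q)) a = 0"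
  then have "q dvd pderiv q"
    by (intro irreducible_common_root_imp_dvd[OF assms, of a]) (simp_all add: rat_to_pderiv)
  moreover have "pderiv q \<noteq> 0"
    using irreducible_degree_pos[OF assms] by (simp add: pderiv_eq_0_iff)
  ultimately have "degree q \<le> degree (pderiv q)"
    by (rule dvd_imp_degree_le)
  then show False
    using irreducible_degree_pos[OF assms] by (simp add: degree_pderiv)
qed

abbreviation lin_prod :: "'a::comm_ring_1 list \<Rightarrow> 'a poly" where
  "lin_prod bs \<equiv> (\<Prod>b\<leftarrow>bs. [:- b, 1:])"

lemma poly_lin_prod: "poly (lin_prod bs) x = (\<Prod>b\<leftarrow>bs. x - b)"
  by (induction bs) (simp_all add: algebra_simps)

lemma poly_lin_prod_eq_0_iff: "poly (lin_prod bs) x = 0 \<longleftrightarrow> x \<in> set bs"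
  for x :: "'a::idom"
  by (induction bs) auto

lemma lin_prod_nz: "lin_prod bs \<noteq> (0 :: 'a::idom poly)"
  by (induction bs) (simp_all del: mult_pCons_left)

lemma degree_lin_prod: "degree (lin_prod bs :: 'a::idom poly) = length bs"
  by (induction bs) (simp_all add: degree_mult_eq lin_prod_nz del: mult_pCons_left)

lemma split_into_linear_factors:
  fixes f :: "'k::field poly"
  assumes closed: "\<And>P :: 'k poly. degree P > 0 \<Longrightarrow> \<exists>x. poly P x = 0"
  shows "f \<noteq> 0 \<Longrightarrow> \<exists>bs. f = smult (lead_coeff f) (lin_prod bs)"
proof (induction "degree f" arbitrary: f)
  case 0
  then show ?case
    by (intro exI[of _ "[]"]) (auto elim: degree_eq_zeroE)
next
  case (Suc n)
  obtain b where "poly f b = 0"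
    using closed[of f] Suc.hyps(2) by auto
  then obtain g where g: "f = [:- b, 1:] * g"
    by (auto simp: poly_eq_0_iff_dvd)
  then have g0: "g \<noteq> 0"
    using Suc.prems by auto
  have "degree f = Suc (degree g)"
    unfolding g using g0 by (simp add: degree_mult_eq del: mult_pCons_left)
  then obtain bs where bs: "g = smult (lead_coeff g) (lin_prod bs)"
    using Suc g0 by auto
  have "lead_coeff f = lead_coeff g"
    unfolding g by (simp add: lead_coeff_mult del: mult_pCons_left)
  moreover have "f = smult (lead_coeff g) (lin_prod (b # bs))"
    using arg_cong[OF bs, of "(*) [:- b, 1:]"] g by (simp del: mult_pCons_left)
  ultimately show ?case
    by metis
qed

section \<open>Non-archimedean absolute values and Gauss norms\<close>

text \<open>Absolute values are written multiplicatively; a valuation \<open>v\<close> gives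
  \<open>nm x = exp (- v x)\<close>.\<close>
locale nonarch_norm =
  fixes nm :: "'k::field_char_0 \<Rightarrow> real"
  assumes nm_nonneg [simp]: "nm x \<ge> 0"
    and nm_eq_0_iff [simp]: "nm x = 0 \<longleftrightarrow> x = 0"
    and nm_mult: "nm (x * y) = nm x * nm y"
    and nm_add: "nm (x + y) \<le> max (nm x) (nm y)"
begin

lemma nm_0 [simp]: "nm 0 = 0"
  by simp

lemma nm_pos_iff [simp]: "nm x > 0 \<longleftrightarrow> x \<noteq> 0"
  using nm_nonneg[of x] nm_eq_0_iff[of x] by linarith

lemma nm_1 [simp]: "nm 1 = 1"
  using nm_mult[of 1 1] nm_eq_0_iff[of 1] by simp

lemma nm_minus [simp]: "nm (- x) = nm x"
proof -
  have "nm (- 1) * nm (- 1) = 1"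
    using nm_mult[of "- 1" "- 1"] by simp
  then have "nm (- 1) = 1"
    using nm_nonneg[of "- 1"] by (metis abs_of_nonneg abs_mult_self_eq real_sqrt_abs2 real_sqrt_one)
  then show ?thesis
    using nm_mult[of "- 1" x] by simp
qed

lemma nm_diff: "nm (x - y) \<le> max (nm x) (nm y)"
  using nm_add[of x "- y"] by simp

lemma nm_diff_commute: "nm (x - y) = nm (y - x)"
  using nm_minus[of "x - y"] by simp

lemma nm_power: "nm (x ^ n) = nm x ^ n"
  by (induction n) (simp_all add: nm_mult)

lemma nm_inverse: "nm (inverse x) = inverse (nm x)"
proof (cases "x = 0")
  case False
  then have "nm x * nm (inverse x) = 1"
    by (simp flip: nm_mult)
  then show ?thesis
    by (simp add: inverse_unique)
qed simp

lemma nm_divide: "nm (x / y) = nm x / nm y"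
  by (simp add: divide_inverse nm_mult nm_inverse)

lemma nm_prod_list: "nm (\<Prod>b\<leftarrow>bs. h b) = (\<Prod>b\<leftarrow>bs. nm (h b))"
  by (induction bs) (simp_all add: nm_mult)

lemma nm_add_le: "nm x \<le> t \<Longrightarrow> nm y \<le> t \<Longrightarrow> nm (x + y) \<le> t"
  using nm_add[of x y] by linarith

lemma nm_diff_le: "nm x \<le> t \<Longrightarrow> nm y \<le> t \<Longrightarrow> nm (x - y) \<le> t"
  using nm_diff[of x y] by linarith

lemma nm_triangle: "nm (x - y) \<le> t \<Longrightarrow> nm (y - z) \<le> t \<Longrightarrow> nm (x - z) \<le> t"
  using nm_add_le[of "x - y" t "y - z"] by simp

lemma nm_sum_le:
  assumes "finite A" "t \<ge> 0" "\<And>i. i \<in> A \<Longrightarrow> nm (h i) \<le> t"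
  shows "nm (sum h A) \<le> t"
  using assms by (induction A rule: finite_induct) (auto intro: nm_add_le)

text \<open>Isosceles triangle principle: \<open>x\<close> is recovered as
  \<open>(x + y) - y\<close>, so the sum cannot be smaller than the dominant term.\<close>

lemma nm_add_eq:
  assumes "nm y < nm x"
  shows "nm (x + y) = nm x"
proof -
  have "nm x \<le> max (nm (x + y)) (nm y)"
    using nm_diff[of "x + y" y] by simp
  moreover have "nm (x + y) \<le> nm x"
    using nm_add[of x y] assms by linarith
  ultimately show ?thesis
    using assms by linarith
qed

text \<open>The case \<open>r = 0\<close> is meaningful: since \<open>0 ^ 0 = 1\<close>, it bounds the value of \<open>f\<close> at \<open>a\<close>.\<close>
definition gauss_le :: "'k \<Rightarrow> real \<Rightarrow> real \<Rightarrow> 'k poly \<Rightarrow> bool" where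
  "gauss_le a r t f \<longleftrightarrow> (\<forall>i. nm (coeff (pcompose f [:a, 1:]) i) * r ^ i \<le> t)"

lemma gauss_le_0: "gauss_le a 0 t f \<longleftrightarrow> nm (poly f a) \<le> t \<and> 0 \<le> t"
proof -
  have "coeff (pcompose f [:a, 1:]) 0 = poly f a"
    by (simp flip: poly_0_coeff_0 add: poly_pcompose)
  then show ?thesis
    unfolding gauss_le_def
    by (auto simp: power_0_left split: if_splits)
qed

lemma gauss_le_mono: "gauss_le a r s f \<Longrightarrow> s \<le> t \<Longrightarrow> gauss_le a r t f"
  unfolding gauss_le_def by (meson order_trans)

lemma gauss_le_nonneg: "r \<ge> 0 \<Longrightarrow> gauss_le a r t f \<Longrightarrow> t \<ge> 0"
  unfolding gauss_le_def by (metis mult_nonneg_nonneg nm_nonneg order_trans zero_le_power)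

lemma gauss_le_add:
  assumes "r \<ge> 0" "gauss_le a r t f" "gauss_le a r t g"
  shows "gauss_le a r t (f + g)"
  unfolding gauss_le_def
proof
  fix i
  have "nm (coeff (pcompose (f + g) [:a, 1:]) i) * r ^ i
    \<le> max (nm (coeff (pcompose f [:a, 1:]) i)) (nm (coeff (pcompose g [:a, 1:]) i)) * r ^ i"
    using assms(1) nm_add by (intro mult_right_mono) (auto simp: pcompose_add)
  also have "\<dots> \<le> t"
    using assms unfolding gauss_le_def by (auto simp: max_def)
  finally show "nm (coeff (pcompose (f + g) [:a, 1:]) i) * r ^ i \<le> t" .
qed

lemma gauss_le_mult:
  assumes r: "r \<ge> 0" and f: "gauss_le a r s f" and g: "gauss_le a r t g"
  shows "gauss_le a r (s * t) (f * g)"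
  unfolding gauss_le_def
proof
  fix i
  let ?f = "coeff (pcompose f [:a, 1:])" and ?g = "coeff (pcompose g [:a, 1:])"
  have st: "s \<ge> 0" "t \<ge> 0"
    using gauss_le_nonneg r f g by auto
  show "nm (coeff (pcompose (f * g) [:a, 1:]) i) * r ^ i \<le> s * t"
  \<comment> \<open>For \<open>r = 0\<close> all indices above 0 contribute nothing; otherwise
    \<open>r ^ i\<close> is positive and may be moved to the other side.\<close>
  proof (cases "r = 0 \<and> i > 0")
    case True
    then show ?thesis
      using st by (simp add: power_0_left)
  next
    case False
    then have ri: "r ^ i > 0"
      using r by (cases "i = 0") auto
    have "nm (\<Sum>j\<le>i. ?f j * ?g (i - j)) \<le> s * t / r ^ i"
    proof (rule nm_sum_le)
      fix j assume "j \<in> {..i}"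
      then have "nm (?f j * ?g (i - j)) * r ^ i
          = (nm (?f j) * r ^ j) * (nm (?g (i - j)) * r ^ (i - j))"
        by (simp add: nm_mult flip: power_add)
      also have "\<dots> \<le> s * t"
        using f g r st unfolding gauss_le_def by (intro mult_mono) auto
      finally show "nm (?f j * ?g (i - j)) \<le> s * t / r ^ i"
        using ri by (simp add: pos_le_divide_eq)
    qed (use st ri in auto)
    then show ?thesis
      using ri by (simp add: pcompose_mult coeff_mult pos_le_divide_eq)
  qed
qed

lemma gauss_le_const: "gauss_le a r t [:c:] \<longleftrightarrow> nm c \<le> t \<and> 0 \<le> t"
proof -
  have coeff: "nm (coeff (pcompose [:c:] [:a, 1:]) i) * r ^ i = (if i = 0 then nm c else 0)" for i
    by (cases i) auto
  show ?thesis
    unfolding gauss_le_def coeff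
  proof
    assume "\<forall>i::nat. (if i = 0 then nm c else 0) \<le> t"
    then have "(if (0::nat) = 0 then nm c else 0) \<le> t" "(if (1::nat) = 0 then nm c else 0) \<le> t"
      by blast+
    then show "nm c \<le> t \<and> 0 \<le> t"
      by simp
  qed simp
qed

lemma gauss_le_1: "gauss_le a r 1 1"
  using gauss_le_const[of a r 1 1] by (simp add: pCons_one)

lemma gauss_le_smult:
  assumes "r \<ge> 0" "gauss_le a r t f"
  shows "gauss_le a r (nm c * t) (smult c f)"
  using gauss_le_mult[OF assms(1) _ assms(2), of "nm c" "[:c:]"] by (simp add: gauss_le_const)

lemma gauss_le_power:
  assumes "r \<ge> 0" "gauss_le a r t f"
  shows "gauss_le a r (t ^ n) (f ^ n)"
  using assms by (induction n) (auto intro: gauss_le_1 gauss_le_mult)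

lemma gauss_le_linear:
  assumes "r \<ge> 0"
  shows "gauss_le a r (max r (nm (a - b))) [:- b, 1:]"
  unfolding gauss_le_def
proof
  fix i
  have "pcompose [:- b, 1:] [:a, 1:] = [:a - b, 1:]"
    by (simp add: pcompose_pCons)
  moreover have "nm (coeff [:a - b, 1:] i) * r ^ i \<le> max r (nm (a - b))"
    using assms by (auto simp: coeff_pCons le_max_iff_disj split: nat.split)
  ultimately show "nm (coeff (pcompose [:- b, 1:] [:a, 1:]) i) * r ^ i \<le> max r (nm (a - b))"
    by simp
qed

lemma gauss_le_lin_prod:
  assumes "r \<ge> 0"
  shows "gauss_le a r (\<Prod>b\<leftarrow>bs. max r (nm (a - b))) (lin_prod bs)"
proof (induction bs)
  case (Cons b bs)
  then show ?case
    using gauss_le_mult[OF assms gauss_le_linear[OF assms, of a b] Cons] by simp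
qed (simp add: gauss_le_1)

lemma gauss_le_exists:
  assumes "r \<ge> 0"
  obtains t where "t > 0" "gauss_le a r t f"
proof -
  let ?h = "\<lambda>i. nm (coeff (pcompose f [:a, 1:]) i) * r ^ i"
  let ?t = "1 + (\<Sum>i\<le>degree (pcompose f [:a, 1:]). ?h i)"
  have nn: "?h i \<ge> 0" for i
    using assms by simp
  then have s: "?t \<ge> 1"
    by (simp add: sum_nonneg)
  have "?h i \<le> ?t" for i
  proof (cases "i \<le> degree (pcompose f [:a, 1:])")
    case True
    then show ?thesis
      using member_le_sum[of i "{..degree (pcompose f [:a, 1:])}" ?h] nn by simp
  next
    case False
    then show ?thesis
      using s by (simp add: coeff_eq_0)
  qed
  then show ?thesis
    using that[of ?t] s by (auto simp: gauss_le_def)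
qed

lemma gauss_le_poly:
  assumes r: "r \<ge> 0" and f: "gauss_le a r t f" and x: "nm (x - a) \<le> r"
  shows "nm (poly f x) \<le> t"
proof -
  let ?g = "pcompose f [:a, 1:]"
  have "poly f x = poly ?g (x - a)"
    by (simp add: poly_pcompose)
  also have "\<dots> = (\<Sum>i\<le>degree ?g. coeff ?g i * (x - a) ^ i)"
    by (rule poly_altdef)
  also have "nm \<dots> \<le> t"
  proof (rule nm_sum_le)
    fix i assume "i \<in> {..degree ?g}"
    have "nm (coeff ?g i * (x - a) ^ i) \<le> nm (coeff ?g i) * r ^ i"
      using x by (simp add: nm_mult nm_power mult_left_mono power_mono)
    also have "\<dots> \<le> t"
      using f unfolding gauss_le_def by blast
    finally show "nm (coeff ?g i * (x - a) ^ i) \<le> t" .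
  qed (use gauss_le_nonneg[OF r f] in auto)
  finally show ?thesis .
qed

end

section \<open>Conjugates over a complete subfield\<close>

text \<open>\<open>F\<close> will be the closure of the rationals, a copy of the p-adic numbers in
  the big field. Completeness is asked of \<open>F\<close> because the limits taken below are limits
  of coefficients.\<close>

locale complete_subfield = nonarch_norm +
  fixes F :: "'a set"
  assumes alg_closed: "\<And>P :: 'a poly. degree P > 0 \<Longrightarrow> \<exists>x. poly P x = 0"
    and F_1: "1 \<in> F"
    and F_diff: "x \<in> F \<Longrightarrow> y \<in> F \<Longrightarrow> x - y \<in> F"
    and F_mult: "x \<in> F \<Longrightarrow> y \<in> F \<Longrightarrow> x * y \<in> F"
    and F_inverse: "x \<in> F \<Longrightarrow> inverse x \<in> F"
    and F_complete: "(\<And>n. s n \<in> F) \<Longrightarrow>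
      (\<And>e. e > 0 \<Longrightarrow> \<exists>N. \<forall>m\<ge>N. \<forall>n\<ge>N. nm (s m - s n) \<le> e) \<Longrightarrow>
      \<exists>L\<in>F. (\<lambda>n. nm (s n - L)) \<longlonglongrightarrow> 0"
begin

section \<open>Polynomials with coefficients in the subfield\<close>

lemma F_0: "0 \<in> F"
  using F_diff[OF F_1 F_1] by simp

lemma F_add: "x \<in> F \<Longrightarrow> y \<in> F \<Longrightarrow> x + y \<in> F"
  using F_diff[of x "0 - y"] F_diff[OF F_0, of y] by simp

lemma F_sum: "(\<And>i. i \<in> A \<Longrightarrow> h i \<in> F) \<Longrightarrow> sum h A \<in> F"
  by (induction A rule: infinite_finite_induct) (auto intro: F_add F_0)

definition FX :: "'a poly set" where
  "FX = {f. \<forall>i. coeff f i \<in> F}"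

lemma FX_coeff: "f \<in> FX \<Longrightarrow> coeff f i \<in> F"
  by (simp add: FX_def)

lemma FX_0: "0 \<in> FX"
  by (simp add: FX_def F_0)

lemma FX_pCons: "c \<in> F \<Longrightarrow> f \<in> FX \<Longrightarrow> pCons c f \<in> FX"
  by (auto simp: FX_def coeff_pCons split: nat.split)

lemma FX_pConsD: "pCons c f \<in> FX \<Longrightarrow> c \<in> F \<and> f \<in> FX"
  unfolding FX_def by (auto dest: spec[of _ 0]) (metis coeff_pCons_Suc)

lemma FX_1: "1 \<in> FX"
  by (simp add: one_pCons FX_pCons F_1 FX_0)

lemma FX_add: "f \<in> FX \<Longrightarrow> g \<in> FX \<Longrightarrow> f + g \<in> FX"
  by (simp add: FX_def F_add)

lemma FX_diff: "f \<in> FX \<Longrightarrow> g \<in> FX \<Longrightarrow> f - g \<in> FX"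
  by (simp add: FX_def F_diff)

lemma FX_mult: "f \<in> FX \<Longrightarrow> g \<in> FX \<Longrightarrow> f * g \<in> FX"
  by (auto simp: FX_def coeff_mult intro!: F_sum F_mult)

lemma FX_smult: "c \<in> F \<Longrightarrow> f \<in> FX \<Longrightarrow> smult c f \<in> FX"
  by (simp add: FX_def F_mult)

lemma FX_power: "f \<in> FX \<Longrightarrow> f ^ n \<in> FX"
  by (induction n) (simp_all add: FX_1 FX_mult)

lemma FX_monom: "c \<in> F \<Longrightarrow> monom c n \<in> FX"
  by (simp add: FX_def F_0)

text \<open>Eliminating the top coefficient against a monic divisor uses ring operations only, so
  quotient and remainder keep their coefficients in \<open>F\<close>.\<close>

lemma FX_divide_monic:
  assumes g: "g \<in> FX" "lead_coeff g = 1" "degree g > 0"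
  shows "f \<in> FX \<Longrightarrow> \<exists>k\<in>FX. \<exists>r\<in>FX. f = g * k + r \<and> degree r < degree g"
proof (induction f)
  case 0
  show ?case
    using FX_0 g by (intro bexI[of _ 0]) auto
next
  case (pCons a f)
  then obtain k r where kr: "k \<in> FX" "r \<in> FX" "f = g * k + r" "degree r < degree g"
    using FX_pConsD by blast
  have a: "a \<in> F"
    using pCons.prems FX_pConsD by blast
  \<comment> \<open>\<open>pCons a r\<close> has degree at most \<open>degree g\<close>; subtracting
    \<open>c\<close> times the monic \<open>g\<close> removes the one coefficient that may be left
    in that degree.\<close>
  define c where "c = coeff (pCons a r) (degree g)"
  define r' where "r' = pCons a r - smult c g"
  have "c \<in> F"
    unfolding c_def using a kr by (intro FX_coeff FX_pCons)
  then have "pCons c k \<in> FX" "r' \<in> FX"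
    unfolding r'_def using kr a g by (auto intro!: FX_pCons FX_diff FX_smult)
  moreover have "pCons a f = g * pCons c k + r'"
    unfolding r'_def kr(3) by (simp add: algebra_simps)
  moreover have "degree r' < degree g"
  proof (rule degree_lessI)
    show "r' \<noteq> 0 \<or> degree g > 0"
      using g by simp
    show "\<forall>i\<ge>degree g. coeff r' i = 0"
    proof (intro allI impI)
      fix i assume i: "i \<ge> degree g"
      have "degree (pCons a r) \<le> degree g"
        using kr(4) by simp
      then show "coeff r' i = 0"
        using i g(2) by (cases "i = degree g") (auto simp: r'_def c_def coeff_eq_0)
    qed
  qed
  ultimately show ?case
    by blast
qed

text \<open>\<open>h\<close> is the k-th Hasse derivative of \<open>g\<close>. Having one polynomial
  over \<open>F\<close> for all \<open>b\<close> lets Taylor coefficients at conjugate points be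
  compared as values of \<open>h\<close>.\<close>

lemma taylor_coeff_FX:
  "g \<in> FX \<Longrightarrow> \<exists>h\<in>FX. \<forall>b. coeff (pcompose g [:b, 1:]) k = poly h b"
proof (induction g arbitrary: k)
  case 0
  show ?case
    using FX_0 by (intro bexI[of _ 0]) auto
next
  case (pCons a g)
  have a: "a \<in> F" and g: "g \<in> FX"
    using pCons.prems FX_pConsD by blast+
  obtain h where h: "h \<in> FX" "\<And>b. coeff (pcompose g [:b, 1:]) k = poly h b"
    using pCons.IH[OF g, of k] by blast
  show ?case
  proof (cases k)
    case 0
    have "coeff (pcompose (pCons a g) [:b, 1:]) k = poly (pCons a h) b" for b
      unfolding pcompose_pCons_shift coeff_add coeff_linear_mult using h(2)[of b] 0 by simp
    then show ?thesis
      using FX_pCons a h(1) by blast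
  next
    case (Suc l)
    obtain h' where h': "h' \<in> FX" "\<And>b. coeff (pcompose g [:b, 1:]) l = poly h' b"
      using pCons.IH[OF g, of l] by blast
    have "coeff (pcompose (pCons a g) [:b, 1:]) k = poly (pCons 0 h + h') b" for b
      unfolding pcompose_pCons_shift coeff_add coeff_linear_mult using h(2)[of b] h'(2)[of b] Suc
      by simp
    then show ?thesis
      using FX_pCons F_0 FX_add h(1) h'(1) by blast
  qed
qed

section \<open>Comparison of coefficients with values\<close>

lemma poly_eq_sum_lessThan:
  assumes "\<And>i. i \<ge> n \<Longrightarrow> coeff h i = 0"
  shows "poly h (x :: 'a) = (\<Sum>i<n. coeff h i * x ^ i)"
  unfolding poly_altdef
proof (rule sum.mono_neutral_cong)
  fix i assume "i \<in> {..<n} - {..degree h}"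
  then show "coeff h i * x ^ i = 0"
    by (auto simp: coeff_eq_0)
qed (use assms in auto)

lemma nm_poly_le:
  assumes "\<And>i. i \<ge> n \<Longrightarrow> coeff h i = 0" "\<And>i. nm (coeff h i) \<le> t"
  shows "nm (poly h x) \<le> t * max 1 (nm x) ^ n"
proof -
  have eq: "poly h x = (\<Sum>i<n. coeff h i * x ^ i)"
    by (rule poly_eq_sum_lessThan) (rule assms(1))
  show ?thesis
    unfolding eq
  proof (rule nm_sum_le)
    have t: "t \<ge> 0"
      using assms(2)[of 0] nm_nonneg[of "coeff h 0"] by linarith
    then show "t * max 1 (nm x) ^ n \<ge> 0"
      by simp
    fix i assume i: "i \<in> {..<n}"
    have "nm x ^ i \<le> max 1 (nm x) ^ i"
      by (intro power_mono) auto
    also have "\<dots> \<le> max 1 (nm x) ^ n"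
      using i by (intro power_increasing) auto
    finally show "nm (coeff h i * x ^ i) \<le> t * max 1 (nm x) ^ n"
      using assms(2)[of i] t by (auto simp: nm_mult nm_power intro!: mult_mono)
  qed simp
qed

text \<open>A finite-dimensional space over a complete field carries only one topology. The induction
  step uses that the span of the lower powers is complete, hence closed, so that \<open>b ^ n\<close> has
  positive distance from it.\<close>
lemma coeff_bound:
  assumes "\<And>h. h \<in> FX \<Longrightarrow> (\<And>i. i \<ge> n \<Longrightarrow> coeff h i = 0) \<Longrightarrow> poly h b = 0 \<Longrightarrow> h = 0"
  shows "\<exists>c>0. \<forall>h\<in>FX. (\<forall>i\<ge>n. coeff h i = 0) \<longrightarrow> (\<forall>i. nm (coeff h i) \<le> c * nm (poly h b))"
  using assms
proof (induction n)
  case 0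
  show ?case
    by (intro exI[of _ 1]) auto
next
  case (Suc n)
  define W where "W = {h \<in> FX. \<forall>i\<ge>n. coeff h i = 0}"
  obtain c where c: "c > 0" "\<And>h i. h \<in> W \<Longrightarrow> nm (coeff h i) \<le> c * nm (poly h b)"
  proof -
    have "\<exists>c>0. \<forall>h\<in>FX. (\<forall>i\<ge>n. coeff h i = 0) \<longrightarrow> (\<forall>i. nm (coeff h i) \<le> c * nm (poly h b))"
      using Suc.prems by (intro Suc.IH) auto
    then show ?thesis
      using that unfolding W_def by blast
  qed
  have W_diff: "g - h \<in> W" if "g \<in> W" "h \<in> W" for g h
    using that unfolding W_def by (auto intro: FX_diff)
  \<comment> \<open>Otherwise values of polynomials in \<open>W\<close> approach
    \<open>- (b ^ n)\<close>. By the induction bound their coefficients are Cauchy and converge in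
    \<open>F\<close>; the limit \<open>G\<close> makes \<open>monom 1 n + G\<close> vanish at
    \<open>b\<close>, against the assumed independence.\<close>
  have "\<exists>e>0. \<forall>h\<in>W. nm (b ^ n + poly h b) \<ge> e"
  proof (rule ccontr)
    assume "\<not> ?thesis"
    then have "\<forall>k. \<exists>h\<in>W. nm (b ^ n + poly h b) < inverse (real (Suc k))"
      by (metis inverse_positive_iff_positive not_le of_nat_0_less_iff zero_less_Suc)
    then obtain H where H: "\<And>k. H k \<in> W" "\<And>k. nm (b ^ n + poly (H k) b) < inverse (real (Suc k))"
      by metis
    have close: "nm (coeff (H k) i - coeff (H l) i) \<le> c * inverse (real (Suc N))"
      if "k \<ge> N" "l \<ge> N" for k l N i
    proof -
      have small: "nm (b ^ n + poly (H k) b) \<le> inverse (real (Suc N))" if "k \<ge> N" for k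
      proof -
        have "inverse (real (Suc k)) \<le> inverse (real (Suc N))"
          using that by (intro le_imp_inverse_le) auto
        then show ?thesis
          using H(2)[of k] by linarith
      qed
      have "nm (poly (H k - H l) b) \<le> inverse (real (Suc N))"
        using nm_diff_le[OF small[OF that(1)] small[OF that(2)]] by simp
      then have "c * nm (poly (H k - H l) b) \<le> c * inverse (real (Suc N))"
        using c(1) by (intro mult_left_mono) auto
      then show ?thesis
        using c(2)[OF W_diff[OF H(1)[of k] H(1)[of l]], of i] by simp
    qed
    have "\<exists>L\<in>F. (\<lambda>k. nm (coeff (H k) i - L)) \<longlonglongrightarrow> 0" for i
    proof (rule F_complete)
      show "coeff (H k) i \<in> F" for k
        using H(1)[of k] FX_coeff unfolding W_def by blast
      fix e :: real assume "e > 0"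
      then obtain N where "inverse (real (Suc N)) < e / c"
        using reals_Archimedean[of "e / c"] c(1) by auto
      then have "c * inverse (real (Suc N)) \<le> e"
        using c(1) by (simp add: field_simps)
      then show "\<exists>N. \<forall>k\<ge>N. \<forall>l\<ge>N. nm (coeff (H k) i - coeff (H l) i) \<le> e"
        using close by (meson order_trans)
    qed
    then obtain L where L: "\<And>i. L i \<in> F" "\<And>i. (\<lambda>k. nm (coeff (H k) i - L i)) \<longlonglongrightarrow> 0"
      by metis
    define G where "G = (\<Sum>i<n. monom (L i) i)"
    have coeff_G: "coeff G i = (if i < n then L i else 0)" for i
      unfolding G_def by (simp add: coeff_sum)
    have G: "G \<in> W"
      unfolding W_def FX_def using L(1) F_0 by (auto simp: coeff_G)
    have le: "nm (b ^ n + poly G b)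
      \<le> inverse (real (Suc k)) + (\<Sum>i<n. nm (coeff (H k) i - L i) * nm b ^ i)" for k
    proof -
      have "poly (H k - G) b = (\<Sum>i<n. coeff (H k - G) i * b ^ i)"
        using W_diff[OF H(1)[of k] G] by (intro poly_eq_sum_lessThan) (auto simp: W_def)
      also have "\<dots> = (\<Sum>i<n. (coeff (H k) i - L i) * b ^ i)"
        by (intro sum.cong) (auto simp: coeff_G)
      also have "nm \<dots> \<le> (\<Sum>i<n. nm (coeff (H k) i - L i) * nm b ^ i)"
      proof (rule nm_sum_le)
        fix i assume "i \<in> {..<n}"
        then show "nm ((coeff (H k) i - L i) * b ^ i)
          \<le> (\<Sum>i<n. nm (coeff (H k) i - L i) * nm b ^ i)"
          using member_le_sum[of i "{..<n}" "\<lambda>i. nm (coeff (H k) i - L i) * nm b ^ i"]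
          by (simp add: nm_mult nm_power)
      qed (auto intro: sum_nonneg)
      finally have 1: "nm (poly (H k - G) b) \<le> (\<Sum>i<n. nm (coeff (H k) i - L i) * nm b ^ i)" .
      have "b ^ n + poly G b = (b ^ n + poly (H k) b) - poly (H k - G) b"
        by simp
      then have "nm (b ^ n + poly G b) \<le> max (nm (b ^ n + poly (H k) b)) (nm (poly (H k - G) b))"
        by (metis nm_diff)
      also have "\<dots> \<le> nm (b ^ n + poly (H k) b) + nm (poly (H k - G) b)"
        by simp
      also have "\<dots> \<le> inverse (real (Suc k)) + (\<Sum>i<n. nm (coeff (H k) i - L i) * nm b ^ i)"
        using H(2)[of k] 1 by linarith
      finally show ?thesis .
    qed
    have "(\<lambda>k. inverse (real (Suc k)) + (\<Sum>i<n. nm (coeff (H k) i - L i) * nm b ^ i))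
      \<longlonglongrightarrow> 0 + (\<Sum>i<n. 0 * nm b ^ i)"
      by (intro tendsto_add tendsto_sum tendsto_mult L(2) LIMSEQ_inverse_real_of_nat tendsto_const)
    then have "nm (b ^ n + poly G b) \<le> 0 + (\<Sum>i<n. 0 * nm b ^ i)"
      by (rule LIMSEQ_le_const) (use le in auto)
    then have "nm (b ^ n + poly G b) = 0"
      using nm_nonneg[of "b ^ n + poly G b"] by simp
    then have "poly (monom 1 n + G) b = 0"
      by (simp add: poly_monom)
    moreover have "monom 1 n + G \<in> FX"
      using G FX_add FX_monom F_1 unfolding W_def by blast
    ultimately have "monom 1 n + G = 0"
      by (intro Suc.prems) (auto simp: coeff_G)
    then have "coeff (monom 1 n + G) n = 0"
      by simp
    then show False
      by (simp add: coeff_G)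
  qed
  then obtain e where e: "e > 0" "\<And>h. h \<in> W \<Longrightarrow> nm (b ^ n + poly h b) \<ge> e"
    by blast
  \<comment> \<open>The first entry serves the coefficient of index \<open>n\<close>, the second the
    lower ones, which belong to \<open>h - monom a n\<close>.\<close>
  define C where "C = max (inverse e) (c * max 1 (inverse e * nm b ^ n))"
  have "C > 0"
    unfolding C_def using e(1) by (simp add: less_max_iff_disj)
  moreover have "nm (coeff h i) \<le> C * nm (poly h b)"
    if h: "h \<in> FX" "\<forall>i\<ge>Suc n. coeff h i = 0" for h i
  proof -
    define a where "a = coeff h n"
    define g where "g = h - monom a n"
    have a: "a \<in> F"
      unfolding a_def using FX_coeff h(1) by blast
    have "coeff g i = 0" if "i \<ge> n" for i
      using h(2) that by (cases "i = n") (auto simp: g_def a_def)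
    then have g: "g \<in> W"
      unfolding W_def using a h(1) by (auto simp: g_def intro!: FX_diff FX_monom)
    have hg: "poly h b = a * b ^ n + poly g b"
      by (simp add: g_def poly_monom)
    \<comment> \<open>Dividing \<open>h\<close> by its top coefficient \<open>a\<close> gives a
      value of the form \<open>b ^ n\<close> plus a value of \<open>W\<close>, to which the distance
      \<open>e\<close> applies.\<close>
    have na: "nm a \<le> inverse e * nm (poly h b)"
    proof (cases "a = 0")
      case True
      then show ?thesis
        using e(1) by simp
    next
      case False
      have "smult (inverse a) g \<in> W"
        using g a unfolding W_def by (auto intro: FX_smult F_inverse)
      then have "e \<le> nm (b ^ n + inverse a * poly g b)"
        using e(2)[of "smult (inverse a) g"] by simp
      also have "b ^ n + inverse a * poly g b = poly h b / a"
        using False by (simp add: hg field_simps)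
      finally show ?thesis
        using False e(1) by (simp add: nm_divide field_simps)
    qed
    have hb: "nm (a * b ^ n) \<le> max 1 (inverse e * nm b ^ n) * nm (poly h b)"
    proof -
      have "nm (a * b ^ n) \<le> inverse e * nm (poly h b) * nm b ^ n"
        using na by (simp add: nm_mult nm_power mult_right_mono)
      also have "\<dots> = (inverse e * nm b ^ n) * nm (poly h b)"
        by simp
      also have "\<dots> \<le> max 1 (inverse e * nm b ^ n) * nm (poly h b)"
        by (intro mult_right_mono) auto
      finally show ?thesis .
    qed
    have "nm (poly g b) \<le> max 1 (inverse e * nm b ^ n) * nm (poly h b)"
    proof -
      have "1 * nm (poly h b) \<le> max 1 (inverse e * nm b ^ n) * nm (poly h b)"
        by (intro mult_right_mono) auto
      then show ?thesis
        using nm_diff_le[OF _ hb, of "poly h b"] by (simp add: hg)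
    qed
    then have cg: "nm (coeff g i) \<le> c * max 1 (inverse e * nm b ^ n) * nm (poly h b)"
      using c(2)[OF g, of i] c(1) by (smt (verit, best) mult.assoc mult_left_mono)
    have C1: "inverse e * nm (poly h b) \<le> C * nm (poly h b)"
      and C2: "c * max 1 (inverse e * nm b ^ n) * nm (poly h b) \<le> C * nm (poly h b)"
      unfolding C_def by (intro mult_right_mono; simp)+
    show ?thesis
    proof (cases "i = n")
      case True
      then show ?thesis
        using na C1 by (simp add: a_def)
    next
      case False
      then have "coeff h i = coeff g i"
        by (simp add: g_def)
      then show ?thesis
        using cg C2 by simp
    qed
  qed
  ultimately show ?case
    by blast
qed

text \<open>Minimality is phrased as independence of the powers of \<open>b\<close> below the
  degree, which is the hypothesis of \<open>coeff_bound\<close>.\<close>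

definition is_minpoly :: "'a \<Rightarrow> 'a poly \<Rightarrow> bool" where
  "is_minpoly b f \<longleftrightarrow> f \<in> FX \<and> lead_coeff f = 1 \<and> poly f b = 0 \<and>
     (\<forall>h\<in>FX. (\<forall>i\<ge>degree f. coeff h i = 0) \<longrightarrow> poly h b = 0 \<longrightarrow> h = 0)"

lemma minpoly_exists:
  assumes "h \<in> FX" "h \<noteq> 0" "poly h b = 0"
  obtains f where "is_minpoly b f" "degree f \<le> degree h"
proof -
  let ?P = "\<lambda>h. h \<in> FX \<and> h \<noteq> 0 \<and> poly h b = 0"
  obtain g where g: "?P g" "\<And>k. ?P k \<Longrightarrow> degree g \<le> degree k"
    using ex_has_least_nat[of ?P h degree] assms by blast
  define f where "f = smult (inverse (lead_coeff g)) g"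
  have deg: "degree f = degree g"
    using g(1) by (simp add: f_def)
  have "k = 0" if "k \<in> FX" "\<forall>i\<ge>degree f. coeff k i = 0" "poly k b = 0" for k
  proof (rule ccontr)
    assume "k \<noteq> 0"
    then have "degree f \<le> degree k"
      using g(2)[of k] that deg by simp
    then show False
      using that(2) \<open>k \<noteq> 0\<close> by auto
  qed
  moreover have "f \<in> FX"
    unfolding f_def using g(1) FX_smult F_inverse FX_coeff by blast
  ultimately have "is_minpoly b f"
    unfolding is_minpoly_def using g(1) by (auto simp: f_def)
  then show ?thesis
    using that g(2)[of h] assms deg by simp
qed

lemma minpolyD:
  assumes "is_minpoly b f"
  shows "f \<in> FX" "lead_coeff f = 1" "poly f b = 0" "f \<noteq> 0"
    "\<And>h. h \<in> FX \<Longrightarrow> degree h < degree f \<Longrightarrow> poly h b = 0 \<Longrightarrow> h = 0"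
proof -
  show "f \<in> FX" "lead_coeff f = 1" "poly f b = 0"
    using assms unfolding is_minpoly_def by blast+
  then show "f \<noteq> 0"
    by auto
  fix h assume "h \<in> FX" "degree h < degree f" "poly h b = 0"
  moreover from this have "\<forall>i\<ge>degree f. coeff h i = 0"
    by (simp add: coeff_eq_0)
  ultimately show "h = 0"
    using assms unfolding is_minpoly_def by blast
qed

lemma minpoly_degree_pos:
  assumes "is_minpoly b f"
  shows "degree f > 0"
proof (rule ccontr)
  assume "\<not> ?thesis"
  then obtain c where "f = [:c:]"
    by (auto elim: degree_eq_zeroE)
  then show False
    using minpolyD(3,4)[OF assms] by simp
qed

text \<open>If \<open>b'\<close> had a minimal polynomial \<open>g\<close> of smaller degree,
  division would exhibit \<open>f\<close> as \<open>g\<close> times a cofactor, both of smaller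
  degree than \<open>f\<close>, and one of them would vanish at \<open>b\<close>.\<close>

lemma minpoly_conj:
  assumes f: "is_minpoly b f" and root: "poly f b' = 0"
  shows "is_minpoly b' f"
  unfolding is_minpoly_def
proof (intro conjI ballI impI)
  show fX: "f \<in> FX" and "lead_coeff f = 1" "poly f b' = 0"
    by (simp_all add: root minpolyD(1,2)[OF f])
  fix h assume h: "h \<in> FX" "\<forall>i\<ge>degree f. coeff h i = 0" "poly h b' = 0"
  show "h = 0"
  proof (rule ccontr)
    assume "h \<noteq> 0"
    then obtain g where g: "is_minpoly b' g" "degree g \<le> degree h"
      using minpoly_exists[OF h(1) _ h(3)] by blast
    have "degree h < degree f"
      using h(2) \<open>h \<noteq> 0\<close> by (meson leading_coeff_0_iff not_le)
    then have deg: "degree g < degree f"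
      using g(2) by simp
    obtain k r where kr: "k \<in> FX" "r \<in> FX" "f = g * k + r" "degree r < degree g"
      using FX_divide_monic[OF minpolyD(1,2)[OF g(1)] minpoly_degree_pos[OF g(1)] fX] by blast
    have "poly r b' = 0"
      using root minpolyD(3)[OF g(1)] by (simp add: kr(3))
    then have "r = 0"
      using minpolyD(5)[OF g(1)] kr(2,4) by blast
    then have fgk: "f = g * k"
      using kr(3) by simp
    then have "g \<noteq> 0" "k \<noteq> 0"
      using minpolyD(4)[OF f] by auto
    then have "degree f = degree g + degree k"
      by (simp add: fgk degree_mult_eq)
    then have "degree k < degree f"
      using minpoly_degree_pos[OF g(1)] by simp
    then have "poly k b \<noteq> 0" "poly g b \<noteq> 0"
      using minpolyD(5)[OF f] kr(1) minpolyD(1)[OF g(1)] deg \<open>g \<noteq> 0\<close> \<open>k \<noteq> 0\<close> by blast+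
    then show False
      using minpolyD(3)[OF f] by (simp add: fgk)
  qed
qed

text \<open>Uniqueness of the extension of the absolute value: a power of \<open>h\<close>, reduced modulo \<open>f\<close>,
  takes values at \<open>b\<close> and \<open>b'\<close> that are comparable up to a constant independent of the exponent.\<close>
lemma nm_conj_le:
  assumes f: "is_minpoly b f" and root: "poly f b' = 0" and h: "h \<in> FX"
  shows "nm (poly h b) \<le> nm (poly h b')"
proof -
  have "\<exists>c>0. \<forall>h\<in>FX. (\<forall>i\<ge>degree f. coeff h i = 0) \<longrightarrow>
    (\<forall>i. nm (coeff h i) \<le> c * nm (poly h b'))"
  proof (rule coeff_bound)
    show "h = 0" if "h \<in> FX" "\<And>i. i \<ge> degree f \<Longrightarrow> coeff h i = 0" "poly h b' = 0" for h
      using minpoly_conj[OF f root] that unfolding is_minpoly_def by blast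
  qed
  then obtain c where c: "c > 0"
    "\<forall>h\<in>FX. (\<forall>i\<ge>degree f. coeff h i = 0) \<longrightarrow> (\<forall>i. nm (coeff h i) \<le> c * nm (poly h b'))"
    by (elim exE conjE)
  let ?B = "max 1 (nm b) ^ degree f"
  have "nm (poly h b) ^ k \<le> (c * ?B) * nm (poly h b') ^ k" for k
  proof -
    obtain g r where gr: "r \<in> FX" "h ^ k = f * g + r" "degree r < degree f"
      using FX_divide_monic[OF minpolyD(1,2)[OF f] minpoly_degree_pos[OF f] FX_power[OF h]]
      by blast
    have rb: "poly r b = poly h b ^ k" "poly r b' = poly h b' ^ k"
      using minpolyD(3)[OF f] root arg_cong[OF gr(2), of "\<lambda>p. poly p b"]
        arg_cong[OF gr(2), of "\<lambda>p. poly p b'"]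
      by (simp_all add: poly_power)
    have r0: "coeff r i = 0" if "i \<ge> degree f" for i
      using gr(3) that by (simp add: coeff_eq_0)
    then have "nm (coeff r i) \<le> c * nm (poly r b')" for i
      using c(2) gr(1) by blast
    then have "nm (poly r b) \<le> c * nm (poly r b') * ?B"
      by (intro nm_poly_le r0)
    then show ?thesis
      by (simp add: rb nm_power mult_ac)
  qed
  then show ?thesis
    by (rule power_le_const_mult_power_imp_le[OF nm_nonneg nm_nonneg])
qed

lemma nm_conj:
  assumes "is_minpoly b f" "poly f b' = 0" "h \<in> FX"
  shows "nm (poly h b') = nm (poly h b)"
  using nm_conj_le[OF assms]
    nm_conj_le[OF minpoly_conj[OF assms(1,2)] minpolyD(3)[OF assms(1)] assms(3)]
  by (intro antisym)

text \<open>The distance from a conjugate of \<open>b\<close> to the root set of a polynomial over \<open>F\<close> does not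
  depend on the conjugate: it can be read off the Taylor coefficients, which are values at \<open>b\<close>
  of polynomials over \<open>F\<close>.\<close>
lemma root_distance_conj:
  assumes f: "is_minpoly b f" "poly f b' = 0"
    and g: "lin_prod xs \<in> FX" and d: "d > 0" "\<And>x. x \<in> set xs \<Longrightarrow> nm (x - b) \<ge> d"
    and x: "x \<in> set xs"
  shows "nm (x - b') \<ge> d"
proof (rule ccontr)
  assume "\<not> ?thesis"
  then have close: "nm (x - b') < d"
    by simp
  let ?g = "lin_prod xs"
  define t where "t = nm (poly ?g b)"
  have "poly ?g b \<noteq> 0"
    unfolding poly_lin_prod_eq_0_iff using d by force
  then have t: "t > 0"
    by (simp add: t_def)
  have "(\<Prod>x\<leftarrow>xs. max d (nm (b - x))) = (\<Prod>x\<leftarrow>xs. nm (b - x))"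
    using d(2) by (intro arg_cong[of _ _ prod_list] map_cong) (auto simp: nm_diff_commute max_def)
  then have "gauss_le b d t ?g"
    using gauss_le_lin_prod[of d b xs] d(1) by (simp add: t_def poly_lin_prod nm_prod_list)
  \<comment> \<open>No root lies within \<open>d\<close> of \<open>b\<close>, so the bound on the
    disc of radius \<open>d\<close> is just the value at \<open>b\<close>. Each Taylor coefficient
    at \<open>b'\<close> has the same norm as at \<open>b\<close>, so the bound carries
    over.\<close>
  then have gauss: "gauss_le b' d t ?g"
    unfolding gauss_le_def using taylor_coeff_FX[OF g] nm_conj[OF f] by metis
  define G where "G = pcompose ?g [:b', 1:]"
  obtain c G' where G: "G = pCons c G'"
    by (cases G)
  have "poly G (x - b') = 0"
    unfolding G_def using x by (simp add: poly_pcompose poly_lin_prod_eq_0_iff)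
  then have "(x - b') * poly G' (x - b') = - c"
    unfolding G by (simp add: eq_neg_iff_add_eq_0 add.commute)
  then have "nm (x - b') * nm (poly G' (x - b')) = nm c"
    by (metis nm_minus nm_mult)
  moreover have "c = poly ?g b'"
  proof -
    have "c = poly G 0"
      by (simp add: G)
    then show ?thesis
      by (simp add: G_def poly_pcompose)
  qed
  then have "nm c = t"
    using nm_conj[OF f g] by (simp add: t_def)
  ultimately have eq: "nm (x - b') * nm (poly G' (x - b')) = t"
    by simp
  \<comment> \<open>A Newton polygon argument: a root at distance less than \<open>d\<close> from
    \<open>b'\<close> would make the constant term \<open>c\<close>, up to sign
    \<open>(x - b') * poly G' (x - b')\<close>, smaller than \<open>t\<close>, although its norm is
    \<open>t\<close>.\<close>
  have "nm (coeff G' i) * d ^ i \<le> t / d" for i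
  proof -
    have "nm (coeff G (Suc i)) * d ^ Suc i \<le> t"
      using gauss unfolding gauss_le_def G_def by blast
    then show ?thesis
      using d(1) by (simp add: G field_simps)
  qed
  then have "gauss_le 0 d (t / d) G'"
    by (simp add: gauss_le_def)
  then have "nm (poly G' (x - b')) \<le> t / d"
    using close d(1) by (intro gauss_le_poly[of d 0]) auto
  then have "nm (x - b') * nm (poly G' (x - b')) \<le> nm (x - b') * (t / d)"
    by (intro mult_left_mono) auto
  also have "\<dots> < d * (t / d)"
    using close d(1) t by (intro mult_strict_right_mono) auto
  finally show False
    using eq d(1) by simp
qed

text \<open>Every root \<open>y\<close> of \<open>f\<close> has distance at least \<open>D\<close> from every conjugate \<open>x\<close> of \<open>\<xi>\<close>. So if a
  disc lies within distance \<open>D\<close> of \<open>x\<close>, each factor \<open>X - y\<close> is at most as large on it as at \<open>x\<close>.\<close>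
lemma centre_minpoly_bounds:
  assumes xi: "is_minpoly \<xi> g" "g = lin_prod xs"
    and f: "is_minpoly b f" "f = lin_prod bs"
    and D: "D > 0" "\<forall>x\<in>set xs. nm (x - b) \<ge> D"
  shows "poly f \<xi> \<noteq> 0"
    and "\<And>a r x. r > 0 \<Longrightarrow> x \<in> set xs \<Longrightarrow> nm (x - a) \<le> D \<Longrightarrow> r \<le> D
      \<Longrightarrow> gauss_le a r (nm (poly f \<xi>)) f"
    and "\<And>r. 0 < r \<Longrightarrow> r < D \<Longrightarrow> \<exists>t < nm (poly f \<xi>). gauss_le b r t f"
proof -
  have far: "nm (x - y) \<ge> D" if "x \<in> set xs" "y \<in> set bs" for x y
  proof (rule root_distance_conj[OF f(1) _ _ D(1)])
    show "poly f y = 0"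
      using that(2) unfolding f(2) poly_lin_prod_eq_0_iff .
    show "lin_prod xs \<in> FX"
      using minpolyD(1)[OF xi(1)] xi(2) by simp
  qed (use that D(2) in auto)
  \<comment> \<open>All conjugates of \<xi> give the same norm of \<open>f\<close>, so each estimate
    may use whichever conjugate \<open>x\<close> is convenient.\<close>
  have val: "nm (poly f \<xi>) = (\<Prod>y\<leftarrow>bs. nm (x - y))" if "x \<in> set xs" for x
  proof -
    have "poly g x = 0"
      using that unfolding xi(2) poly_lin_prod_eq_0_iff .
    then show ?thesis
      using nm_conj[OF xi(1) _ minpolyD(1)[OF f(1)]] f(2) by (simp add: poly_lin_prod nm_prod_list)
  qed
  have "\<xi> \<in> set xs"
    using minpolyD(3)[OF xi(1)] unfolding xi(2) poly_lin_prod_eq_0_iff .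
  have "b \<in> set bs"
    using minpolyD(3)[OF f(1)] unfolding f(2) poly_lin_prod_eq_0_iff .
  show "poly f \<xi> \<noteq> 0"
  proof
    assume "poly f \<xi> = 0"
    then have "\<xi> \<in> set bs"
      unfolding f(2) poly_lin_prod_eq_0_iff .
    then show False
      using far[OF \<open>\<xi> \<in> set xs\<close>] D(1) by fastforce
  qed
  show "gauss_le a r (nm (poly f \<xi>)) f"
    if r: "r > 0" "r \<le> D" and x: "x \<in> set xs" "nm (x - a) \<le> D" for a r x
  proof -
    have "max r (nm (a - y)) \<le> nm (x - y)" if "y \<in> set bs" for y
      using far[OF x(1) that] r(2) x(2) nm_triangle[of a x "nm (x - y)" y]
      by (simp add: nm_diff_commute)
    then have "(\<Prod>y\<leftarrow>bs. max r (nm (a - y))) \<le> nm (poly f \<xi>)"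
      unfolding val[OF x(1)] using prod_list_map_mono[of bs] r(1) by (simp add: le_max_iff_disj)
    then show ?thesis
      using gauss_le_mono[OF gauss_le_lin_prod[of r a bs]] r(1) f(2) by simp
  qed
  show "\<exists>t < nm (poly f \<xi>). gauss_le b r t f" if r: "0 < r" "r < D" for r
  proof -
    \<comment> \<open>With \<open>x\<close> a conjugate nearest to \<open>b\<close>, every root
      \<open>y\<close> of \<open>f\<close> is at least as far from \<open>x\<close> as
      \<open>b\<close> is; hence \<open>b - y\<close> is never larger than \<open>x - y\<close>. The
      factor with \<open>y = b\<close> is strictly smaller on the disc, since \<open>r\<close> is
      below this distance.\<close>
    define x where "x = arg_min_on (\<lambda>x. nm (x - b)) (set xs)"
    have x: "x \<in> set xs" "\<And>z. z \<in> set xs \<Longrightarrow> nm (x - b) \<le> nm (z - b)"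
      unfolding x_def using \<open>\<xi> \<in> set xs\<close>
      by (auto intro!: arg_min_if_finite(1) arg_min_least[where f = "\<lambda>x. nm (x - b)"])
    define D' where "D' = nm (x - b)"
    have "D' \<ge> D"
      using D(2) x(1) by (simp add: D'_def)
    have far': "nm (x - y) \<ge> D'" if "y \<in> set bs" for y
    proof (rule root_distance_conj[OF f(1)])
      show "poly f y = 0"
        using that unfolding f(2) poly_lin_prod_eq_0_iff .
      show "lin_prod xs \<in> FX"
        using minpolyD(1)[OF xi(1)] xi(2) by simp
      show "D' > 0"
        using \<open>D' \<ge> D\<close> D(1) by simp
    qed (use x in \<open>auto simp: D'_def\<close>)
    have "max r (nm (b - y)) \<le> nm (x - y)" if "y \<in> set bs" for y
      using far'[OF that] r(2) \<open>D' \<ge> D\<close> nm_triangle[of b x "nm (x - y)" y]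
      by (simp add: nm_diff_commute D'_def)
    moreover have "max r (nm (b - b)) < nm (x - b)"
      using r \<open>D' \<ge> D\<close> by (simp add: D'_def)
    ultimately have "(\<Prod>y\<leftarrow>bs. max r (nm (b - y))) < nm (poly f \<xi>)"
      unfolding val[OF x(1)] using prod_list_map_strict_mono[of bs _ _ b] \<open>b \<in> set bs\<close> r(1)
      by (simp add: less_max_iff_disj)
    then show ?thesis
      using gauss_le_lin_prod[of r b bs] r(1) f(2) by auto
  qed
qed

section \<open>Separating one root from all discs\<close>

lemma monic_split:
  fixes f :: "'a poly"
  assumes "lead_coeff f = 1"
  obtains bs where "f = lin_prod bs"
  using split_into_linear_factors[OF alg_closed, of f] assms by force

text \<open>The discs are added in order of increasing distance from the conjugates of \<open>\<xi>\<close>; a high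
  power of the minimal polynomial of the new centre then makes the product small on the new disc
  without spoiling the bounds on the earlier ones.\<close>
lemma separating_polynomial:
  fixes b :: "'i \<Rightarrow> 'a" and r :: "'i \<Rightarrow> real"
  assumes S: "finite S" and xi: "is_minpoly \<xi> g"
    and alg: "\<And>j. j \<in> S \<Longrightarrow> \<exists>h\<in>FX. h \<noteq> 0 \<and> poly h (b j) = 0"
    and r: "\<And>j. j \<in> S \<Longrightarrow> r j > 0"
    and far: "\<And>j x. j \<in> S \<Longrightarrow> poly g x = 0 \<Longrightarrow> nm (x - b j) > r j"
  obtains f t where "f \<in> FX" "0 < t" "t < nm (poly f \<xi>)" "\<And>j. j \<in> S \<Longrightarrow> gauss_le (b j) (r j) t f"
proof -
  obtain xs :: "'a list" where xs: "g = lin_prod xs"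
    using monic_split[OF minpolyD(2)[OF xi]] by blast
  have "\<xi> \<in> set xs"
    using minpolyD(3)[OF xi] unfolding xs poly_lin_prod_eq_0_iff .
  define d where "d j = Min ((\<lambda>x. nm (x - b j)) ` set xs)" for j
  have d_le: "d j \<le> nm (x - b j)" if "x \<in> set xs" for j x
    unfolding d_def using that by simp
  have d_eq: "\<exists>x\<in>set xs. d j = nm (x - b j)" for j
  proof -
    have "d j \<in> (\<lambda>x. nm (x - b j)) ` set xs"
      unfolding d_def using \<open>\<xi> \<in> set xs\<close> by (intro Min_in) auto
    then show ?thesis
      by auto
  qed
  have r_less: "r j < d j" if "j \<in> S" for j
    using d_eq[of j] far[OF that] unfolding xs poly_lin_prod_eq_0_iff by auto
  have ex: "\<exists>f t. f \<in> FX \<and> 0 < t \<and> t < nm (poly f \<xi>) \<and> (\<forall>j\<in>T. gauss_le (b j) (r j) t f)"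
    if "finite T" "T \<subseteq> S" for T
    using that
  \<comment> \<open>This rule inserts \<open>i\<close> only when \<open>d i\<close> is at least
    every earlier \<open>d j\<close>. Each earlier centre then has a conjugate of \<xi> within
    \<open>d i\<close>, and its radius is below \<open>d i\<close>, as the second bound of
    \<open>centre_minpoly_bounds\<close> requires.\<close>
  proof (induction T rule: finite_ranking_induct[where f = d])
    case empty
    show ?case
      by (intro exI[of _ 1] exI[of _ "1 / 2"]) (simp add: FX_1)
  next
    case (insert i T)
    have i: "i \<in> S" and T: "T \<subseteq> S"
      using insert.prems by auto
    obtain f t where f: "f \<in> FX" "0 < t" "t < nm (poly f \<xi>)"
      "\<And>j. j \<in> T \<Longrightarrow> gauss_le (b j) (r j) t f"
      using insert by auto
    obtain k where "k \<in> FX" "k \<noteq> 0" "poly k (b i) = 0"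
      using alg[OF i] by blast
    then obtain h where h: "is_minpoly (b i) h"
      using minpoly_exists[of k "b i"] by blast
    obtain bs :: "'a list" where bs: "h = lin_prod bs"
      using monic_split[OF minpolyD(2)[OF h]] by blast
    have di: "d i > 0"
      using r_less[OF i] r[OF i] by simp
    have "\<forall>x\<in>set xs. nm (x - b i) \<ge> d i"
      using d_le by blast
    note bounds = centre_minpoly_bounds[OF xi xs h bs di this]
    define c where "c = nm (poly h \<xi>)"
    have c: "c > 0"
      unfolding c_def using bounds(1) by simp
    have hT: "gauss_le (b j) (r j) c h" if j: "j \<in> T" for j
    proof -
      obtain x where "x \<in> set xs" "d j = nm (x - b j)"
        using d_eq by blast
      then show ?thesis
        unfolding c_def using bounds(2)[of "r j" x "b j"] r_less[of j] r[of j] insert.hyps(2)[OF j] T j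
        by force
    qed
    obtain u where u: "u < c" "gauss_le (b i) (r i) u h"
      unfolding c_def using bounds(3)[OF r[OF i] r_less[OF i]] by auto
    have u0: "u \<ge> 0"
      using gauss_le_nonneg[OF less_imp_le[OF r[OF i]] u(2)] .
    obtain s where s: "s > 0" "gauss_le (b i) (r i) s f"
      using gauss_le_exists[OF less_imp_le[OF r[OF i]]] by blast
    define v where "v = nm (poly f \<xi>)"
    have v: "v > 0"
      unfolding v_def using f(2,3) by linarith
    \<comment> \<open>On the new disc each factor \<open>h\<close> gains \<open>u / c < 1\<close>
      relative to its value at \<xi>, which eventually beats the uncontrolled bound \<open>s\<close>
      of \<open>f\<close>. On the earlier discs the gap between \<open>t\<close> and
      \<open>v\<close> survives any \<open>n\<close>.\<close>
    obtain n where n: "(u / c) ^ n < v / s"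
      using real_arch_pow_inv[of "v / s" "u / c"] v s(1) u(1) c by auto
    then have n: "s * u ^ n < v * c ^ n"
      using s(1) c by (simp add: power_divide field_simps)
    let ?f = "f * h ^ n"
    let ?t = "max (t * c ^ n) (s * u ^ n)"
    have fxi: "nm (poly ?f \<xi>) = v * c ^ n"
      by (simp add: v_def c_def nm_mult nm_power poly_power)
    have "gauss_le (b j) (r j) ?t ?f" if j: "j \<in> T" for j
    proof -
      have rj: "r j \<ge> 0"
        using r[of j] T j by force
      have "gauss_le (b j) (r j) (t * c ^ n) ?f"
        by (rule gauss_le_mult[OF rj f(4)[OF j] gauss_le_power[OF rj hT[OF j]]])
      then show ?thesis
        by (rule gauss_le_mono) simp
    qed
    moreover have "gauss_le (b i) (r i) ?t ?f"
    proof -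
      have ri: "r i \<ge> 0"
        using r[OF i] by simp
      have "gauss_le (b i) (r i) (s * u ^ n) ?f"
        by (rule gauss_le_mult[OF ri s(2) gauss_le_power[OF ri u(2)]])
      then show ?thesis
        by (rule gauss_le_mono) simp
    qed
    ultimately have "\<forall>j\<in>insert i T. gauss_le (b j) (r j) ?t ?f"
      by blast
    moreover have "?f \<in> FX"
      using f(1) minpolyD(1)[OF h] FX_mult FX_power by blast
    moreover have "0 < ?t"
      using f(2) c by (simp add: less_max_iff_disj)
    moreover have "?t < nm (poly ?f \<xi>)"
      unfolding fxi using n f(3) c by (simp add: v_def)
    ultimately show ?case
      by blast
  qed
  show ?thesis
    using ex[OF S order_refl] that by blast
qed

end

section \<open>Rational polynomials\<close>

text \<open>\<open>nm_p\<close> records the normalisation in which \<open>p\<close> has valuation 1.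
  \<open>F_approx\<close> makes coefficients rational, and \<open>algebraic_dense\<close> supplies
  algebraic substitutes for transcendental centres.\<close>

locale padic_closed_field = complete_subfield +
  fixes p :: nat
  assumes nm_p: "nm (of_nat p) = exp (- 1)"
    and F_rat: "of_rat c \<in> F"
    and F_approx: "x \<in> F \<Longrightarrow> e > 0 \<Longrightarrow> \<exists>c. nm (x - of_rat c) \<le> e"
    and algebraic_dense: "e > 0 \<Longrightarrow> \<exists>y P. P \<noteq> 0 \<and> poly (rat_to P) y = 0 \<and> nm (x - y) \<le> e"
begin

lemma rat_to_FX: "rat_to f \<in> FX"
  by (simp add: FX_def F_rat)

lemma gauss_le_minus: "gauss_le a r t f \<Longrightarrow> gauss_le a r t (- f)"
  by (simp add: gauss_le_def pcompose_uminus)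

text \<open>A Horner scheme: multiplication by X costs at most the factor \<open>M\<close> on all
  these discs, so an error \<open>e / M\<close> in the tail and \<open>e\<close> in the constant
  coefficient suffice. One \<open>f0\<close> serves all discs at once.\<close>

lemma rational_approximation:
  assumes "f \<in> FX" "M > 0" "e > 0"
  shows "\<exists>f0. \<forall>b r. nm b \<le> M \<longrightarrow> 0 \<le> r \<longrightarrow> r \<le> M \<longrightarrow> gauss_le b r e (f - rat_to f0)"
  using assms(1,3)
proof (induction f arbitrary: e)
  case 0
  then have "gauss_le b r e 0" for b r
    using gauss_le_const[of b r e 0] by simp
  then show ?case
    by (intro exI[of _ 0]) simp
next
  case (pCons a f)
  have a: "a \<in> F" and f: "f \<in> FX"
    using pCons.prems FX_pConsD by blast+
  obtain c where c: "nm (a - of_rat c) \<le> e"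
    using F_approx[OF a] pCons.prems by blast
  obtain f0 where f0: "\<And>b r. nm b \<le> M \<Longrightarrow> 0 \<le> r \<Longrightarrow> r \<le> M \<Longrightarrow> gauss_le b r (e / M) (f - rat_to f0)"
    using pCons.IH[OF f, of "e / M"] pCons.prems assms(2) by auto
  have eq: "pCons a f - rat_to (pCons c f0) = [:a - of_rat c:] + [:- 0, 1:] * (f - rat_to f0)"
    by (simp add: rat_to_pCons)
  have "gauss_le b r e (pCons a f - rat_to (pCons c f0))" if br: "nm b \<le> M" "0 \<le> r" "r \<le> M" for b r
    unfolding eq
  proof (rule gauss_le_add[OF br(2)])
    show "gauss_le b r e [:a - of_rat c:]"
      using c pCons.prems(2) by (simp add: gauss_le_const)
    have "gauss_le b r M [:- 0, 1:]"
      by (rule gauss_le_mono[OF gauss_le_linear[OF br(2)]]) (use br in simp)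
    then show "gauss_le b r e ([:- 0, 1:] * (f - rat_to f0))"
      using gauss_le_mult[OF br(2) _ f0[OF br]] assms(2) by force
  qed
  then show ?case
    by blast
qed

lemma nm_p_powi: "nm (of_rat (of_nat p powi a)) = exp (- of_int a)"
proof -
  have *: "nm (of_rat (of_nat p ^ n)) = exp (- of_nat n)" for n
    by (simp add: of_rat_power nm_power nm_p flip: exp_of_nat_mult)
  show ?thesis
  proof (cases "a \<ge> 0")
    case True
    then show ?thesis
      using *[of "nat a"] by (simp add: power_int_def)
  next
    case False
    then have "nm (of_rat (of_nat p powi a)) = inverse (exp (- of_nat (nat (- a))))"
      using *[of "nat (- a)"] by (simp add: power_int_def nm_inverse of_rat_inverse power_inverse)
    then show ?thesis
      using False by (simp add: exp_minus)
  qed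
qed

text \<open>The powers of \<open>p\<close> have as norms exactly the integral powers of
  \<open>exp 1\<close>, so any positive number can be moved into the interval from
  \<open>exp (- 1)\<close> (excluded) to 1.\<close>

lemma scale_to_unit:
  assumes "y > 0"
  obtains c :: rat where "nm (of_rat c) * y \<le> 1" "exp (- 1) < nm (of_rat c) * y"
proof
  define a where "a = \<lceil>ln y\<rceil>"
  have eq: "nm (of_rat (of_nat p powi a)) * y = exp (ln y - of_int a)"
    using assms by (simp add: nm_p_powi exp_diff exp_minus field_simps)
  have "ln y \<le> of_int a" "of_int a < ln y + 1"
    unfolding a_def by linarith+
  then show "nm (of_rat (of_nat p powi a)) * y \<le> 1" "exp (- 1) < nm (of_rat (of_nat p powi a)) * y"
    unfolding eq by auto
qed

lemma rational_separating_polynomial: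
  fixes b :: "'i \<Rightarrow> 'a" and r :: "'i \<Rightarrow> real"
  assumes S: "finite S" and q: "q \<noteq> 0" "poly (rat_to q) \<xi> = 0"
    and alg: "\<And>j. j \<in> S \<Longrightarrow> \<exists>h\<in>FX. h \<noteq> 0 \<and> poly h (b j) = 0"
    and r: "\<And>j. j \<in> S \<Longrightarrow> r j > 0"
    and far: "\<And>j x. j \<in> S \<Longrightarrow> poly (rat_to q) x = 0 \<Longrightarrow> nm (x - b j) > r j"
  shows "\<exists>f. (\<forall>j\<in>S. gauss_le (b j) (r j) 1 (rat_to f)) \<and> nm (poly (rat_to f) \<xi>) > 1"
proof -
  obtain g where g: "is_minpoly \<xi> g"
    using minpoly_exists[of "rat_to q" \<xi>] q rat_to_FX by auto
  \<comment> \<open>Roots of the minimal polynomial \<open>g\<close> are roots of \<open>q\<close>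
    too, because the value of \<open>q\<close> has norm 0 at every conjugate of \<xi>.\<close>
  have g_far: "nm (x - b j) > r j" if "j \<in> S" "poly g x = 0" for j x
  proof -
    have "nm (poly (rat_to q) x) = nm 0"
      using nm_conj[OF g that(2) rat_to_FX, of q] q(2) by simp
    then show ?thesis
      using far[OF that(1)] by simp
  qed
  obtain f t where f: "f \<in> FX" "0 < t" "t < nm (poly f \<xi>)"
    "\<And>j. j \<in> S \<Longrightarrow> gauss_le (b j) (r j) t f"
  proof (rule separating_polynomial[OF S g, where b = b and r = r])
    show "\<exists>h\<in>FX. h \<noteq> 0 \<and> poly h (b j) = 0" "r j > 0" if "j \<in> S" for j
      using alg r that by auto
    show "nm (x - b j) > r j" if "j \<in> S" "poly g x = 0" for j x
      using g_far that .
  qed blast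
  obtain M where M: "M \<ge> 1" "\<And>j. j \<in> S \<Longrightarrow> max (max (nm \<xi>) (nm (b j))) (r j) \<le> M"
    using finite_upper_bound[OF S, of "\<lambda>j. max (max (nm \<xi>) (nm (b j))) (r j)"] by blast
  \<comment> \<open>If \<open>S\<close> is empty, \<open>M\<close> carries no information about
    \<xi>.\<close>
  define M' where "M' = max M (nm \<xi>)"
  have M': "M' > 0" "nm \<xi> \<le> M'" "\<And>j. j \<in> S \<Longrightarrow> nm (b j) \<le> M' \<and> r j \<le> M'"
    unfolding M'_def using M by fastforce+
  obtain f0 where f0: "\<And>b r. nm b \<le> M' \<Longrightarrow> 0 \<le> r \<Longrightarrow> r \<le> M' \<Longrightarrow> gauss_le b r t (f - rat_to f0)"
    using rational_approximation[OF f(1) M'(1) f(2)] by blast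
  have f0_gauss: "gauss_le (b j) (r j) t (rat_to f0)" if j: "j \<in> S" for j
  proof -
    have rj: "r j \<ge> 0"
      using r[OF j] by simp
    have "gauss_le (b j) (r j) t (f + - (f - rat_to f0))"
      using M'(3)[OF j] by (intro gauss_le_add[OF rj f(4)[OF j]] gauss_le_minus f0 rj) auto
    then show ?thesis
      by simp
  qed
  have f0_val: "t < nm (poly (rat_to f0) \<xi>)"
  proof -
    \<comment> \<open>Radius 0 turns the approximation into an estimate of the value at
      \<xi>.\<close>
    have "gauss_le \<xi> 0 t (f - rat_to f0)"
      using M'(1,2) by (intro f0) auto
    then have "nm (poly f \<xi> - poly (rat_to f0) \<xi>) \<le> t"
      by (simp add: gauss_le_0)
    then show ?thesis
      using f(3) nm_add_le[of "poly f \<xi> - poly (rat_to f0) \<xi>" t "poly (rat_to f0) \<xi>"] by force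
  qed
  define s where "s = nm (poly (rat_to f0) \<xi>)"
  have st: "t < s" "0 < s"
    using f0_val f(2) by (auto simp: s_def)
  \<comment> \<open>The scaling below may lose almost a factor \<open>exp 1\<close>; the gap is
    widened beyond it beforehand.\<close>
  obtain n where "exp 1 < (s / t) ^ n"
    using real_arch_pow[of "s / t" "exp 1"] st f(2) by auto
  then have n: "exp 1 * t ^ n < s ^ n"
    using f(2) by (simp add: power_divide field_simps)
  obtain c :: rat where c: "nm (of_rat c) * t ^ n \<le> 1" "exp (- 1) < nm (of_rat c) * t ^ n"
    using scale_to_unit[of "t ^ n"] f(2) by auto
  let ?f = "smult c (f0 ^ n)"
  have "gauss_le (b j) (r j) 1 (rat_to ?f)" if j: "j \<in> S" for j
  proof -
    have rj: "r j \<ge> 0"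
      using r[OF j] by simp
    show ?thesis
      unfolding rat_to_smult rat_to_power
      using gauss_le_mono[OF gauss_le_smult[OF rj gauss_le_power[OF rj f0_gauss[OF j]]] c(1)] .
  qed
  moreover have "nm (poly (rat_to ?f) \<xi>) > 1"
  proof -
    have "1 = exp 1 * exp (- 1 :: real)"
      by (simp flip: exp_add)
    also have "\<dots> < exp 1 * (nm (of_rat c) * t ^ n)"
      using c(2) by (intro mult_strict_left_mono) auto
    also have "\<dots> = nm (of_rat c) * (exp 1 * t ^ n)"
      by simp
    also have "\<dots> \<le> nm (of_rat c) * s ^ n"
      using n by (intro mult_left_mono) auto
    also have "\<dots> = nm (poly (rat_to ?f) \<xi>)"
      by (simp add: rat_to_smult rat_to_power nm_mult nm_power s_def)
    finally show ?thesis .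
  qed
  ultimately show ?thesis
    by blast
qed

text \<open>If \<open>f\<close> is large on \<open>T\<close> but not at \<open>x\<close>, and \<open>g\<close> is large at \<open>x\<close>, then \<open>f ^ n + g\<close> is
  large on both, for large \<open>n\<close>, by the ultrametric inequality.\<close>
lemma simultaneously_large:
  fixes b :: "'i \<Rightarrow> 'a" and r :: "'i \<Rightarrow> real"
  assumes r: "\<And>j. j \<in> S \<Longrightarrow> r j \<ge> 0" and T: "finite T"
    and ex: "\<And>x. x \<in> T \<Longrightarrow>
      \<exists>f. (\<forall>j\<in>S. gauss_le (b j) (r j) 1 (rat_to f)) \<and> nm (poly (rat_to f) x) > 1"
  shows "\<exists>f. (\<forall>j\<in>S. gauss_le (b j) (r j) 1 (rat_to f)) \<and> (\<forall>x\<in>T. nm (poly (rat_to f) x) > 1)"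
  using T ex
proof (induction T rule: finite_induct)
  case empty
  show ?case
    by (intro exI[of _ 1]) (simp add: gauss_le_1 flip: one_pCons)
next
  case (insert x T)
  obtain f where f: "\<forall>j\<in>S. gauss_le (b j) (r j) 1 (rat_to f)" "\<forall>x\<in>T. nm (poly (rat_to f) x) > 1"
  proof -
    have "\<exists>f. (\<forall>j\<in>S. gauss_le (b j) (r j) 1 (rat_to f)) \<and> (\<forall>x\<in>T. nm (poly (rat_to f) x) > 1)"
      by (rule insert.IH) (use insert.prems in simp)
    then show ?thesis
      using that by blast
  qed
  obtain g where g: "\<forall>j\<in>S. gauss_le (b j) (r j) 1 (rat_to g)" "nm (poly (rat_to g) x) > 1"
    using insert.prems[of x] by blast
  show ?case
  proof (cases "nm (poly (rat_to f) x) > 1")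
    case True
    then show ?thesis
      using f by blast
  next
    case False
    have "eventually (\<lambda>n. \<forall>y\<in>T. nm (poly (rat_to g) y) < nm (poly (rat_to f) y) ^ n) sequentially"
      using f(2) by (intro eventually_ball_finite insert.hyps(1) ballI power_eventually_gt) auto
    \<comment> \<open>A positive exponent is required for \<open>f ^ n\<close> to have norm greater
      than 1 on \<open>T\<close>.\<close>
    then have "eventually (\<lambda>n. n > 0 \<and>
        (\<forall>y\<in>T. nm (poly (rat_to g) y) < nm (poly (rat_to f) y) ^ n)) sequentially"
      by (intro eventually_conj eventually_gt_at_top)
    then obtain n where n: "n > 0" "\<And>y. y \<in> T \<Longrightarrow> nm (poly (rat_to g) y) < nm (poly (rat_to f) y) ^ n"
      using eventually_happens'[OF sequentially_bot] by blast
    let ?h = "f ^ n + g"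
    have eq: "poly (rat_to ?h) y = poly (rat_to f) y ^ n + poly (rat_to g) y" for y :: 'a
      by (simp add: rat_to_add rat_to_power)
    have "gauss_le (b j) (r j) 1 (rat_to ?h)" if "j \<in> S" for j
      unfolding rat_to_add rat_to_power
    proof (rule gauss_le_add[OF r[OF that]])
      show "gauss_le (b j) (r j) 1 (rat_to f ^ n)"
        using gauss_le_power[OF r[OF that], of "b j" 1 "rat_to f" n] f(1) that by simp
      show "gauss_le (b j) (r j) 1 (rat_to g)"
        using g(1) that by blast
    qed
    moreover have "nm (poly (rat_to ?h) y) > 1" if y: "y \<in> T" for y
    proof -
      have "nm (poly (rat_to ?h) y) = nm (poly (rat_to f) y) ^ n"
        unfolding eq using nm_add_eq[of "poly (rat_to g) y" "poly (rat_to f) y ^ n"] n(2)[OF y]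
        by (simp add: nm_power)
      then show ?thesis
        using f(2) y n(1) by (simp add: one_less_power)
    qed
    moreover have "nm (poly (rat_to ?h) x) > 1"
    proof -
      have "nm (poly (rat_to f) x ^ n) \<le> 1"
        using False by (simp add: nm_power power_le_one)
      then have "nm (poly (rat_to g) x + poly (rat_to f) x ^ n) = nm (poly (rat_to g) x)"
        using g(2) by (intro nm_add_eq) simp
      then show ?thesis
        unfolding eq using g(2) by (simp add: add.commute)
    qed
    ultimately have "(\<forall>j\<in>S. gauss_le (b j) (r j) 1 (rat_to ?h)) \<and>
        (\<forall>y\<in>insert x T. nm (poly (rat_to ?h) y) > 1)"
      by blast
    then show ?thesis
      by (rule exI)
  qed
qed

text \<open>Newton interpolation, one node at a time: \<open>h\<close> is
  \<open>[:- z, 1:] * k\<close> plus a constant, and at another node \<open>y\<close> the value of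
  \<open>k\<close> is a divided difference. \<open>C\<close> depends only on the nodes and
  \<open>M\<close>. The alternative \<open>h = 0\<close> matters for an empty set of nodes.\<close>

lemma interpolation_bound:
  assumes "finite Z" "M \<ge> 0"
  shows "\<exists>C\<ge>0. \<forall>h e b r. (h = 0 \<or> degree h < card Z) \<and> e \<ge> 0 \<and> (\<forall>z\<in>Z. nm (poly h z) \<le> e) \<and>
    nm b \<le> M \<and> 0 \<le> r \<and> r \<le> M \<longrightarrow> gauss_le b r (C * e) h"
  using assms(1)
proof (induction Z rule: finite_induct)
  case empty
  have "gauss_le b r 0 0" for b r
    using gauss_le_const[of b r 0 0] by simp
  then show ?case
    by (intro exI[of _ 0]) auto
next
  case (insert z Z)
  obtain C where C: "C \<ge> 0" "\<forall>h e b r. (h = 0 \<or> degree h < card Z) \<and> e \<ge> 0 \<and>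
      (\<forall>z\<in>Z. nm (poly h z) \<le> e) \<and> nm b \<le> M \<and> 0 \<le> r \<and> r \<le> M \<longrightarrow> gauss_le b r (C * e) h"
    using insert.IH by (elim exE conjE)
  obtain B where B: "B \<ge> 1" "\<And>y. y \<in> Z \<Longrightarrow> inverse (nm (y - z)) \<le> B"
    using finite_upper_bound[OF insert.hyps(1), of "\<lambda>y. inverse (nm (y - z))"] by blast
  define D where "D = max M (nm z)"
  have D: "D \<ge> 0"
    using assms(2) by (simp add: D_def)
  \<comment> \<open>\<open>B\<close> bounds the division by \<open>y - z\<close>, \<open>C\<close>
    comes from induction, \<open>D\<close> bounds \<open>[:- z, 1:]\<close> on the disc, and 1
    accounts for the constant \<open>poly h z\<close>.\<close>
  have "gauss_le b r ((D * C * B + 1) * e) h"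
    if h: "h = 0 \<or> degree h < card (insert z Z)" and e: "e \<ge> 0"
      "\<forall>y\<in>insert z Z. nm (poly h y) \<le> e" and br: "nm b \<le> M" "0 \<le> r" "r \<le> M" for h e b r
  proof -
    define k where "k = synthetic_div h z"
    have hk: "h = [:- z, 1:] * k + [:poly h z:]"
      using synthetic_div_correct'[of z h] by (simp add: k_def)
    have "k = 0 \<or> degree k < card Z"
    proof (cases "degree h = 0")
      case True
      then show ?thesis
        by (simp add: k_def synthetic_div_eq_0_iff)
    next
      case False
      then have "degree h < Suc (card Z)"
        using h insert.hyps by auto
      then show ?thesis
        using False by (auto simp: k_def degree_synthetic_div)
    qed
    moreover have "\<forall>y\<in>Z. nm (poly k y) \<le> B * e"
    proof
      fix y assume y: "y \<in> Z"
      then have "y - z \<noteq> 0"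
        using insert.hyps(2) by auto
      have "poly h y = (y - z) * poly k y + poly h z"
        using arg_cong[OF hk, of "\<lambda>f. poly f y"] by (simp add: algebra_simps)
      then have "poly k y = (poly h y - poly h z) * inverse (y - z)"
        using \<open>y - z \<noteq> 0\<close> by simp
      then have "nm (poly k y) = nm (poly h y - poly h z) * inverse (nm (y - z))"
        by (simp only: nm_mult nm_inverse)
      also have "\<dots> \<le> e * B"
        using e y B by (intro mult_mono nm_diff_le) auto
      finally show "nm (poly k y) \<le> B * e"
        by (simp add: mult.commute)
    qed
    ultimately have k: "gauss_le b r (C * (B * e)) k"
      using B(1) e(1) br by (intro C(2)[rule_format]) simp
    have "max r (nm (b - z)) \<le> D"
      unfolding D_def using br nm_diff[of b z] by auto
    then have "gauss_le b r D [:- z, 1:]"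
      using gauss_le_mono gauss_le_linear[OF br(2)] by blast
    then have "gauss_le b r (D * (C * (B * e))) ([:- z, 1:] * k)"
      by (rule gauss_le_mult[OF br(2) _ k])
    then have 1: "gauss_le b r ((D * C * B + 1) * e) ([:- z, 1:] * k)"
      by (rule gauss_le_mono) (simp add: algebra_simps e)
    have "0 \<le> D * C * B * e"
      using D C(1) B(1) e(1) by simp
    then have "e \<le> (D * C * B + 1) * e"
      by (simp add: algebra_simps)
    moreover have "nm (poly h z) \<le> e"
      using e(2) by simp
    ultimately have 2: "gauss_le b r ((D * C * B + 1) * e) [:poly h z:]"
      using e(1) unfolding gauss_le_const by linarith
    show ?thesis
      by (subst hk) (rule gauss_le_add[OF br(2) 1 2])
  qed
  moreover have "D * C * B + 1 \<ge> 0"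
    using D C(1) B(1) by simp
  ultimately show ?case
    by blast
qed

text \<open>By separability no linear factor repeats. Hence a remainder modulo \<open>q\<close> has
  degree below the number of roots, and interpolation at the roots controls it.\<close>

lemma card_roots_irreducible:
  assumes "irreducible q"
  shows "card {x :: 'a. poly (rat_to q) x = 0} = degree q"
proof -
  have nz: "rat_to q \<noteq> (0 :: 'a poly)"
    using assms by auto
  obtain bs :: "'a list" where bs: "rat_to q = smult (lead_coeff (rat_to q)) (lin_prod bs)"
    using split_into_linear_factors[OF alg_closed nz] by blast
  define l where "l = lead_coeff (rat_to q :: 'a poly)"
  have l: "l \<noteq> 0" "rat_to q = smult l (lin_prod bs)"
    unfolding l_def using nz by simp (rule bs)
  have roots: "{x. poly (rat_to q) x = 0} = set bs"
    using l(1) by (simp only: l(2) poly_smult mult_eq_0_iff poly_lin_prod_eq_0_iff) simp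
  have "distinct bs"
  proof (rule ccontr)
    assume "\<not> distinct bs"
    then obtain xs ys zs y where split: "bs = xs @ [y] @ ys @ [y] @ zs"
      using not_distinct_decomp by blast
    have "rat_to q = [:- y, 1:] ^ 2 * smult l (lin_prod (xs @ ys @ zs))"
      unfolding l(2) split
      by (simp del: mult_pCons_left mult_pCons_right add: power2_eq_square mult_ac)
    then have "[:- y, 1:] ^ 2 dvd (rat_to q :: 'a poly)"
      by (metis dvd_triv_left)
    then have "2 \<le> order y (rat_to q)"
      using nz by (simp add: order_divides)
    moreover have "order y (rat_to q) = 0 \<or> order y (rat_to q) = 1"
      using irreducible_rsquarefree[OF assms] unfolding rsquarefree_def by blast
    ultimately show False
      by linarith
  qed
  then have "card (set bs) = degree (lin_prod bs)"
    by (simp only: distinct_card degree_lin_prod)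
  also have "\<dots> = degree q"
    using arg_cong[OF l(2), of degree] l(1) by simp
  finally show ?thesis
    by (simp add: roots)
qed

text \<open>Powers of the inverse of \<open>f\<close> modulo \<open>q\<close> have small values at all roots of \<open>q\<close>, hence small
  coefficients by interpolation.\<close>
lemma p_invertible_mod_irreducible:
  fixes b :: "'i \<Rightarrow> 'a" and r :: "'i \<Rightarrow> real"
  assumes S: "finite S" and r: "\<And>j. j \<in> S \<Longrightarrow> r j \<ge> 0" and q: "irreducible q"
    and f: "\<forall>j\<in>S. gauss_le (b j) (r j) 1 (rat_to f)"
    and large: "\<And>x. poly (rat_to q) x = 0 \<Longrightarrow> nm (poly (rat_to f) x) > 1"
  shows "\<exists>g. (\<forall>j\<in>S. gauss_le (b j) (r j) 1 (rat_to g)) \<and> q dvd 1 - of_nat p * g"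
proof -
  define Z where "Z = {x :: 'a. poly (rat_to q) x = 0}"
  have q0: "q \<noteq> 0"
    using q by auto
  then have Z: "finite Z" "card Z = degree q"
    unfolding Z_def using card_roots_irreducible[OF q] poly_roots_finite[of "rat_to q"] by auto
  then have "Z \<noteq> {}"
    using irreducible_degree_pos[OF q] by auto
  then obtain x0 where x0: "x0 \<in> Z"
    by blast
  have "\<not> q dvd f"
  proof
    assume "q dvd f"
    then obtain k where "f = q * k"
      by blast
    then have "poly (rat_to f) x0 = 0"
      using x0 by (simp add: rat_to_mult Z_def)
    then show False
      using large[of x0] x0 by (simp add: Z_def)
  qed
  then obtain a u where au: "a * f + u * q = 1"
    using irreducible_bezout[OF q] by blast
  have inv: "poly (rat_to a) x * poly (rat_to f) x = 1" if "x \<in> Z" for x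
  proof -
    have "poly (rat_to (a * f + u * q)) x = poly (rat_to 1) x"
      using au by simp
    then show ?thesis
      using that by (simp add: rat_to_add rat_to_mult Z_def)
  qed
  obtain M where M: "M \<ge> 1" "\<And>j. j \<in> S \<Longrightarrow> max (nm (b j)) (r j) \<le> M"
    using finite_upper_bound[OF S, of "\<lambda>j. max (nm (b j)) (r j)"] by blast
  obtain C where C: "C \<ge> 0" "\<forall>h e b r. (h = 0 \<or> degree h < card Z) \<and> e \<ge> 0 \<and>
      (\<forall>z\<in>Z. nm (poly h z) \<le> e) \<and> nm b \<le> M \<and> 0 \<le> r \<and> r \<le> M \<longrightarrow> gauss_le b r (C * e) h"
    using interpolation_bound[OF Z(1) order_trans[OF zero_le_one M(1)]] by (elim exE conjE)
  \<comment> \<open>\<open>C * e\<close> must not exceed \<open>exp (- 1)\<close>, the norm of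
    \<open>p\<close>, so that the later division by \<open>p\<close> is affordable; the added 1
    keeps the denominator positive.\<close>
  define e where "e = exp (- 1) / (C + 1)"
  have e: "e > 0" "C * e \<le> exp (- 1)"
    using C(1) by (simp_all add: e_def field_simps)
  have "eventually (\<lambda>n. \<forall>x\<in>Z. 1 / e < nm (poly (rat_to f) x) ^ n) sequentially"
    using large by (intro eventually_ball_finite Z(1) ballI power_eventually_gt) (simp add: Z_def)
  then obtain n where n: "\<And>x. x \<in> Z \<Longrightarrow> 1 / e < nm (poly (rat_to f) x) ^ n"
    using eventually_happens'[OF sequentially_bot] by blast
  \<comment> \<open>\<open>a\<close> inverts \<open>f\<close> modulo \<open>q\<close>. Reduction
    modulo \<open>q\<close> keeps the values at the roots and brings the degree within reach of the
    interpolation bound.\<close>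
  define h where "h = a ^ n mod q"
  have qdvd: "q dvd a ^ n - h"
    unfolding h_def by (simp add: mod_eq_dvd_iff[symmetric])
  have small: "nm (poly (rat_to h) x) \<le> e" if x: "x \<in> Z" for x
  proof -
    obtain k where "a ^ n - h = q * k"
      using qdvd by blast
    then have "poly (rat_to (a ^ n - h)) x = 0"
      using x by (simp add: rat_to_mult Z_def)
    then have "poly (rat_to h) x = poly (rat_to a) x ^ n"
      by (simp add: rat_to_diff rat_to_power)
    moreover have "poly (rat_to a) x ^ n * poly (rat_to f) x ^ n = 1"
      using inv[OF x] by (simp flip: power_mult_distrib)
    ultimately have "nm (poly (rat_to h) x * poly (rat_to f) x ^ n) = 1"
      by simp
    then have prod: "nm (poly (rat_to h) x) * nm (poly (rat_to f) x) ^ n = 1"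
      by (simp only: nm_mult nm_power)
    have pos: "nm (poly (rat_to f) x) ^ n > 0"
      using n[OF x] e(1) by (meson less_trans zero_less_divide_1_iff)
    have "nm (poly (rat_to h) x) = 1 / nm (poly (rat_to f) x) ^ n"
      by (rule eq_divide_imp[OF _ prod]) (use pos in linarith)
    also have "\<dots> \<le> e"
      using n[OF x] e(1) pos by (simp add: field_simps)
    finally show ?thesis .
  qed
  have "h = 0 \<or> degree h < degree q"
    unfolding h_def using degree_mod_less[OF q0] by blast
  then have h_gauss: "gauss_le (b j) (r j) (exp (- 1)) (rat_to h)" if j: "j \<in> S" for j
    using small M(2)[OF j] r[OF j] e Z(2)
    by (intro gauss_le_mono[OF C(2)[rule_format] e(2)]) simp
  let ?c = "inverse (of_nat p) :: rat"
  have p: "p \<noteq> 0"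
    using nm_p by (intro notI) simp
  let ?g = "smult ?c (h * f ^ n)"
  have "gauss_le (b j) (r j) 1 (rat_to ?g)" if j: "j \<in> S" for j
  proof -
    have "nm (of_rat ?c) * (exp (- 1) * 1 ^ n) = 1"
      by (simp add: of_rat_inverse nm_inverse nm_p)
    then show ?thesis
      unfolding rat_to_smult rat_to_mult rat_to_power
      using gauss_le_smult[OF r[OF j] gauss_le_mult[OF r[OF j] h_gauss[OF j]
          gauss_le_power[OF r[OF j] f[rule_format, OF j], of n]], of "of_rat ?c"] by metis
  qed
  moreover have "q dvd 1 - of_nat p * ?g"
  proof -
    have "of_nat p * ?g = h * f ^ n"
      using p by (simp add: of_nat_poly)
    moreover have "q dvd 1 - a * f"
      using au by (metis add_diff_cancel_left' dvd_triv_right)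
    then have "q dvd 1 ^ n - (a * f) ^ n"
      by (metis dvd_trans power_diff_sumr2 dvd_triv_left)
    then have "q dvd (1 - (a * f) ^ n) + (a ^ n - h) * f ^ n"
      using qdvd by (intro dvd_add) auto
    then have "q dvd 1 - h * f ^ n"
      by (simp add: algebra_simps)
    ultimately show ?thesis
      by metis
  qed
  ultimately show ?thesis
    by blast
qed

end

section \<open>The maximality criterion\<close>

lemma subringD:
  assumes "is_subring R"
  shows "1 \<in> R" "0 \<in> R" "x \<in> R \<Longrightarrow> y \<in> R \<Longrightarrow> x - y \<in> R" "x \<in> R \<Longrightarrow> y \<in> R \<Longrightarrow> x * y \<in> R"
proof -
  show R: "1 \<in> R" "x \<in> R \<Longrightarrow> y \<in> R \<Longrightarrow> x - y \<in> R" "x \<in> R \<Longrightarrow> y \<in> R \<Longrightarrow> x * y \<in> R" for x y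
    using assms unfolding is_subring_def by blast+
  show "0 \<in> R"
    using R(2)[OF R(1) R(1)] by simp
qed

lemma subring_of_nat:
  assumes "is_subring R"
  shows "of_nat n \<in> R"
proof (induction n)
  case 0
  then show ?case
    using subringD(2)[OF assms] by simp
next
  case (Suc n)
  have "of_nat n - (0 - 1) \<in> R"
    using Suc subringD[OF assms] by blast
  then show ?case
    by (simp add: add.commute)
qed

lemma subring_power:
  assumes "is_subring R" "x \<in> R"
  shows "x ^ n \<in> R"
  using assms(2) by (induction n) (auto intro: subringD[OF assms(1)])

lemma is_ideal_contracted:
  assumes "is_subring R"
  shows "is_ideal_in R {f \<in> R. q dvd f}"
  unfolding is_ideal_in_def using subringD[OF assms] by auto

text \<open>If \<open>n\<close> is invertible modulo \<open>q\<close> and inverting \<open>n\<close> turns \<open>R\<close> into the whole polynomial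
  ring, then \<open>R\<close> modulo \<open>q\<close> is all of the field \<open>\<rat>[X] / (q)\<close>.\<close>
lemma maximal_contracted:
  fixes R :: "rat poly set" and n :: nat
  assumes R: "is_subring R" and q: "irreducible q"
    and g: "g \<in> R" "q dvd 1 - of_nat n * g"
    and clear: "\<And>f. \<exists>k. of_nat n ^ k * f \<in> R"
  shows "maximal_ideal_in R {f \<in> R. q dvd f}"
  unfolding maximal_ideal_in_def
proof (intro conjI allI impI)
  let ?Q = "{f \<in> R. q dvd f}"
  show "is_ideal_in R ?Q"
    by (rule is_ideal_contracted[OF R])
  have "\<not> q dvd 1"
    using q by (simp add: irreducible_def)
  then show "?Q \<noteq> R"
    using subringD(1)[OF R] by blast
  fix J assume "is_ideal_in R J \<and> ?Q \<subseteq> J"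
  then have J: "J \<subseteq> R" "0 \<in> J" "\<And>x y. x \<in> J \<Longrightarrow> y \<in> J \<Longrightarrow> x - y \<in> J"
    "\<And>r x. r \<in> R \<Longrightarrow> x \<in> J \<Longrightarrow> r * x \<in> J" and QJ: "?Q \<subseteq> J"
    unfolding is_ideal_in_def by blast+
  have J_add: "x + y \<in> J" if "x \<in> J" "y \<in> J" for x y
    using J(3)[OF that(1) J(3)[OF J(2) that(2)]] by simp
  show "J = ?Q \<or> J = R"
  proof (cases "J = ?Q")
    case False
    then obtain h where h: "h \<in> J" "\<not> q dvd h"
      using J(1) QJ by blast
    obtain u w where uw: "u * h + w * q = 1"
      using irreducible_bezout[OF q h(2)] .
    obtain k where k: "of_nat n ^ k * u \<in> R"
      using clear by blast
    let ?N = "of_nat n ^ k :: rat poly"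
    have N: "?N \<in> R"
      by (rule subring_power[OF R subring_of_nat[OF R]])
    have Nuh: "?N * u * h \<in> J"
      by (rule J(4)[OF k h(1)])
    \<comment> \<open>Multiplying the Bezout identity by \<open>n ^ k\<close> brings its first term
      into \<open>J\<close>; the second then lies in \<open>R\<close> and is divisible by
      \<open>q\<close>, so \<open>n ^ k\<close> belongs to \<open>J\<close>.\<close>
    have "?N - ?N * u * h = ?N * (w * q)"
      using uw by (metis add_diff_cancel_left' mult.assoc mult.right_neutral right_diff_distrib)
    then have "q dvd ?N - ?N * u * h"
      by simp
    then have "?N - ?N * u * h \<in> J"
      using QJ subringD(3)[OF R N] Nuh J(1) by blast
    then have NJ: "?N \<in> J"
      using J_add[OF _ Nuh] by fastforce
    have gk: "g ^ k \<in> R"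
      by (rule subring_power[OF R g(1)])
    \<comment> \<open>Modulo \<open>q\<close> the power \<open>g ^ k\<close> inverts
      \<open>n ^ k\<close>, which puts 1 into \<open>J\<close>.\<close>
    have "q dvd 1 ^ k - (of_nat n * g) ^ k"
      using g(2) by (metis dvd_trans power_diff_sumr2 dvd_triv_left)
    then have "q dvd 1 - g ^ k * ?N"
      by (simp add: power_mult_distrib mult.commute)
    moreover have "1 - g ^ k * ?N \<in> R"
      by (intro subringD[OF R] gk N)
    ultimately have "1 - g ^ k * ?N \<in> J"
      using QJ by blast
    then have "1 \<in> J"
      using J_add[OF _ J(4)[OF gk NJ]] by fastforce
    then have "x \<in> J" if "x \<in> R" for x
      using J(4)[OF that] by fastforce
    then show ?thesis
      using J(1) by blast
  qed simp
qed

context padic_closed_field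
begin

text \<open>Around a transcendental centre the disc of radius 0 is replaced by a small disc with
  algebraic centre that contains it and still avoids the roots of \<open>q\<close>.\<close>
lemma algebraic_disc:
  assumes q: "q \<noteq> 0" and far: "\<And>x. poly (rat_to q) x = 0 \<Longrightarrow> nm (x - a) > r"
    and r: "r > 0 \<and> (\<exists>h\<in>FX. h \<noteq> 0 \<and> poly h a = 0) \<or> r = 0"
  shows "\<exists>b s. s > 0 \<and> (\<exists>h\<in>FX. h \<noteq> 0 \<and> poly h b = 0) \<and>
    (\<forall>x. poly (rat_to q) x = 0 \<longrightarrow> nm (x - b) > s) \<and>
    (\<forall>f. gauss_le b s 1 f \<longrightarrow> gauss_le a r 1 f)"
proof (cases "r = 0")
  case False
  then show ?thesis
    using r far by (intro exI[of _ a] exI[of _ r]) blast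
next
  case True
  have "finite {x :: 'a. poly (rat_to q) x = 0}"
    using q by (intro poly_roots_finite) simp
  then obtain s where s: "s > 0" "\<And>x. poly (rat_to q) x = 0 \<Longrightarrow> s < nm (x - a)"
    using finite_pos_lower_bound[of "{x :: 'a. poly (rat_to q) x = 0}" "\<lambda>x. nm (x - a)"] far True
    by auto
  obtain b P where b: "P \<noteq> 0" "poly (rat_to P) b = 0" "nm (a - b) \<le> s"
    using algebraic_dense[OF s(1), of a] by blast
  have "\<exists>h\<in>FX. h \<noteq> 0 \<and> poly h b = 0"
    using b(1,2) rat_to_FX by (intro bexI[of _ "rat_to P"]) auto
  \<comment> \<open>The shift from \<open>a\<close> to \<open>b\<close> is at most \<open>s\<close>
    and so smaller than the distance from \<open>x\<close> to \<open>a\<close>, which therefore does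
    not change.\<close>
  moreover have "nm (x - b) > s" if "poly (rat_to q) x = 0" for x
    using nm_add_eq[of "a - b" "x - a"] s(2)[OF that] b(3) by simp
  moreover have "gauss_le a r 1 f" if "gauss_le b s 1 f" for f
    using gauss_le_poly[of s b 1 f a] that s(1) b(3) True by (simp add: gauss_le_0)
  ultimately show ?thesis
    using s(1) by blast
qed

text \<open>The value 0 of \<rho> encodes \<delta> = \<infinity>: the Gauss condition becomes a
  bound on the value at the centre and the disc shrinks to that point, so both kinds of pairs share
  one formula.\<close>

lemma maximal_iff_no_root_in_discs:
  fixes \<alpha> :: "nat \<Rightarrow> 'a" and \<rho> :: "nat \<Rightarrow> real"
  assumes adm: "\<And>j. j < m \<Longrightarrow> \<rho> j > 0 \<and> (\<exists>h\<in>FX. h \<noteq> 0 \<and> poly h (\<alpha> j) = 0) \<or> \<rho> j = 0"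
    and R_eq: "R = {f. \<forall>j<m. gauss_le (\<alpha> j) (\<rho> j) 1 (rat_to f)}"
    and R: "is_subring R" and q: "irreducible q"
  shows "maximal_ideal_in R {f \<in> R. q dvd f} \<longleftrightarrow>
    \<not> (\<exists>x. poly (rat_to q) x = 0 \<and> (\<exists>j<m. nm (x - \<alpha> j) \<le> \<rho> j))"
proof
  have rho: "\<rho> j \<ge> 0" if "j < m" for j
    using adm[OF that] by auto
  assume max: "maximal_ideal_in R {f \<in> R. q dvd f}"
  show "\<not> (\<exists>x. poly (rat_to q) x = 0 \<and> (\<exists>j<m. nm (x - \<alpha> j) \<le> \<rho> j))"
  proof
    assume "\<exists>x. poly (rat_to q) x = 0 \<and> (\<exists>j<m. nm (x - \<alpha> j) \<le> \<rho> j)"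
    then obtain x j where x: "poly (rat_to q) x = 0" "j < m" "nm (x - \<alpha> j) \<le> \<rho> j"
      by blast
    have le1: "nm (poly (rat_to f) x) \<le> 1" if "f \<in> R" for f
      using gauss_le_poly[OF rho[OF x(2)] _ x(3)] that x(2) unfolding R_eq by blast
    have root: "poly (rat_to f) x = 0" if "q dvd f" for f
      using that x(1) by (auto simp: rat_to_mult)
    define J where "J = {f \<in> R. nm (poly (rat_to f) x) < 1}"
    have "is_ideal_in R J"
      unfolding is_ideal_in_def
    proof (intro conjI ballI)
      show "J \<subseteq> R" "0 \<in> J"
        using subringD(2)[OF R] by (auto simp: J_def)
      show "f - g \<in> J" if "f \<in> J" "g \<in> J" for f g
      proof -
        have "max (nm (poly (rat_to f) x)) (nm (poly (rat_to g) x)) < 1"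
          using that by (simp add: J_def)
        then have "nm (poly (rat_to (f - g)) x) < 1"
          unfolding rat_to_diff poly_diff by (rule le_less_trans[OF nm_diff])
        then show ?thesis
          using that subringD(3)[OF R] by (simp add: J_def)
      qed
      show "r * f \<in> J" if "r \<in> R" "f \<in> J" for r f
      proof -
        have "nm (poly (rat_to (r * f)) x) \<le> 1 * nm (poly (rat_to f) x)"
          using le1[OF that(1)] by (simp add: rat_to_mult nm_mult mult_left_le_one_le)
        then show ?thesis
          using that subringD(4)[OF R] by (simp add: J_def)
      qed
    qed
    moreover have "{f \<in> R. q dvd f} \<subseteq> J"
      using root by (auto simp: J_def)
    ultimately have "J = {f \<in> R. q dvd f} \<or> J = R"
      using max unfolding maximal_ideal_in_def by blast
    moreover have "J \<noteq> R"
    proof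
      assume "J = R"
      then have "1 \<in> J"
        using subringD(1)[OF R] by simp
      then show False
        by (simp add: J_def)
    qed
    \<comment> \<open>\<open>p\<close> separates \<open>J\<close> from the contracted ideal: its
      norm is below 1, but as a nonzero constant it has no root.\<close>
    moreover have "of_nat p \<in> J"
      using subring_of_nat[OF R] by (simp add: J_def of_nat_poly rat_to_pCons nm_p)
    ultimately have "poly (rat_to (of_nat p)) x = 0"
      using root by blast
    then show False
      using nm_p by (simp add: of_nat_poly rat_to_pCons)
  qed
next
  assume none: "\<not> (\<exists>x. poly (rat_to q) x = 0 \<and> (\<exists>j<m. nm (x - \<alpha> j) \<le> \<rho> j))"
  have q0: "q \<noteq> 0"
    using q by auto
  have "\<forall>j\<in>{..<m}. \<exists>b s. s > 0 \<and> (\<exists>h\<in>FX. h \<noteq> 0 \<and> poly h b = 0) \<and>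
    (\<forall>x. poly (rat_to q) x = 0 \<longrightarrow> nm (x - b) > s) \<and>
    (\<forall>f. gauss_le b s 1 f \<longrightarrow> gauss_le (\<alpha> j) (\<rho> j) 1 f)"
  proof
    fix j assume "j \<in> {..<m}"
    then have j: "j < m"
      by simp
    show "\<exists>b s. s > 0 \<and> (\<exists>h\<in>FX. h \<noteq> 0 \<and> poly h b = 0) \<and>
      (\<forall>x. poly (rat_to q) x = 0 \<longrightarrow> nm (x - b) > s) \<and>
      (\<forall>f. gauss_le b s 1 f \<longrightarrow> gauss_le (\<alpha> j) (\<rho> j) 1 f)"
      by (rule algebraic_disc[OF q0 _ adm[OF j]]) (use none j in force)
  qed
  then obtain b s where bs: "\<forall>j\<in>{..<m}. s j > 0 \<and> (\<exists>h\<in>FX. h \<noteq> 0 \<and> poly h (b j) = 0) \<and>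
    (\<forall>x. poly (rat_to q) x = 0 \<longrightarrow> nm (x - b j) > s j) \<and>
    (\<forall>f. gauss_le (b j) (s j) 1 f \<longrightarrow> gauss_le (\<alpha> j) (\<rho> j) 1 f)"
    unfolding bchoice_iff by (elim exE)
  have s: "s j \<ge> 0" if "j \<in> {..<m}" for j
    using bs that by (meson less_imp_le)
  have "\<exists>f. (\<forall>j\<in>{..<m}. gauss_le (b j) (s j) 1 (rat_to f)) \<and>
    (\<forall>x\<in>{x. poly (rat_to q) x = 0}. nm (poly (rat_to f) x) > 1)"
  proof (rule simultaneously_large)
    show "s j \<ge> 0" if "j \<in> {..<m}" for j
      by (rule s[OF that])
    show "finite {x :: 'a. poly (rat_to q) x = 0}"
      using q0 by (intro poly_roots_finite) simp
    fix x :: 'a assume "x \<in> {x. poly (rat_to q) x = 0}"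
    then have x: "poly (rat_to q) x = 0"
      by simp
    show "\<exists>f. (\<forall>j\<in>{..<m}. gauss_le (b j) (s j) 1 (rat_to f)) \<and> nm (poly (rat_to f) x) > 1"
      by (rule rational_separating_polynomial[OF finite_lessThan q0 x]) (use bs in blast)+
  qed
  then obtain f where f: "\<forall>j\<in>{..<m}. gauss_le (b j) (s j) 1 (rat_to f)"
    "\<forall>x\<in>{x. poly (rat_to q) x = 0}. nm (poly (rat_to f) x) > 1"
    by (elim exE conjE)
  have "\<exists>g. (\<forall>j\<in>{..<m}. gauss_le (b j) (s j) 1 (rat_to g)) \<and> q dvd 1 - of_nat p * g"
    by (rule p_invertible_mod_irreducible[OF finite_lessThan s q f(1)]) (use f(2) in simp_all)
  then obtain g where g: "\<forall>j\<in>{..<m}. gauss_le (b j) (s j) 1 (rat_to g)" "q dvd 1 - of_nat p * g"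
    by (elim exE conjE)
  have "g \<in> R"
    unfolding R_eq using g(1) bs by simp
  \<comment> \<open>Each factor \<open>p\<close> divides all Gauss bounds by \<open>exp 1\<close>,
    and a common exponent exists because there are finitely many pairs.\<close>
  moreover have "\<exists>k. of_nat p ^ k * f \<in> R" for f
  proof -
    have "eventually (\<lambda>k. gauss_le (\<alpha> j) (\<rho> j) 1 (rat_to (of_nat p ^ k * f))) sequentially"
      if "j \<in> {..<m}" for j
    proof -
      have rho: "\<rho> j \<ge> 0"
        using adm[of j] that by auto
      obtain t where t: "t > 0" "gauss_le (\<alpha> j) (\<rho> j) t (rat_to f)"
        using gauss_le_exists[OF rho] by blast
      have small: "gauss_le (\<alpha> j) (\<rho> j) 1 (rat_to (of_nat p ^ k * f))" if k: "t < exp 1 ^ k" for k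
      proof -
        have eq: "of_nat p ^ k * f = smult (of_nat p ^ k) f"
          by (simp add: of_nat_poly poly_const_pow)
        have "nm (of_rat (of_nat p ^ k)) = exp (- 1) ^ k"
          by (simp add: of_rat_power nm_power nm_p)
        moreover have "exp (- 1) ^ k * t \<le> 1"
          using k by (simp add: exp_minus power_inverse field_simps)
        ultimately have "nm (of_rat (of_nat p ^ k)) * t \<le> 1"
          by simp
        then show ?thesis
          unfolding eq rat_to_smult by (rule gauss_le_mono[OF gauss_le_smult[OF rho t(2)]])
      qed
      have "eventually (\<lambda>k. t < exp 1 ^ k) sequentially"
        by (rule power_eventually_gt) simp
      then show ?thesis
        by (rule eventually_mono) (rule small)
    qed
    then have "eventually (\<lambda>k. \<forall>j\<in>{..<m}. gauss_le (\<alpha> j) (\<rho> j) 1 (rat_to (of_nat p ^ k * f)))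
      sequentially"
      by (intro eventually_ball_finite) auto
    then obtain k where "\<forall>j\<in>{..<m}. gauss_le (\<alpha> j) (\<rho> j) 1 (rat_to (of_nat p ^ k * f))"
      using eventually_happens'[OF sequentially_bot] by blast
    then show ?thesis
      unfolding R_eq by auto
  qed
  ultimately show "maximal_ideal_in R {f \<in> R. q dvd f}"
    using maximal_contracted[OF R q _ g(2)] by blast
qed

end

section \<open>Passing from the valuation to the absolute value\<close>

context nonarch_norm
begin

definition rat_closure :: "'k set" where
  "rat_closure = {x. \<forall>e>0. \<exists>c. nm (x - of_rat c) \<le> e}"

lemma of_rat_in_rat_closure: "of_rat c \<in> rat_closure"
  unfolding rat_closure_def by (auto intro!: exI[of _ c])

lemma rat_closureE:
  assumes "x \<in> rat_closure" "e > 0"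
  obtains c where "nm (x - of_rat c) \<le> e"
  using assms unfolding rat_closure_def by blast

lemma rat_closure_diff:
  assumes "x \<in> rat_closure" "y \<in> rat_closure"
  shows "x - y \<in> rat_closure"
  unfolding rat_closure_def
proof (intro CollectI allI impI)
  fix e :: real assume e: "e > 0"
  obtain c d where "nm (x - of_rat c) \<le> e" "nm (y - of_rat d) \<le> e"
    using assms e unfolding rat_closure_def by blast
  then have "nm (x - y - of_rat (c - d)) \<le> e"
    using nm_diff_le[of "x - of_rat c" e "y - of_rat d"] by (simp add: of_rat_diff algebra_simps)
  then show "\<exists>c. nm (x - y - of_rat c) \<le> e"
    by blast
qed

lemma rat_closure_mult:
  assumes "x \<in> rat_closure" "y \<in> rat_closure"
  shows "x * y \<in> rat_closure"
  unfolding rat_closure_def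
proof (intro CollectI allI impI)
  fix e :: real assume e: "e > 0"
  \<comment> \<open>The approximation \<open>d\<close> of \<open>y\<close> has error at most 1, so
    \<open>B\<close> bounds its norm before the precision for \<open>x\<close> is chosen.\<close>
  define B where "B = max 1 (nm y)"
  obtain d where d: "nm (y - of_rat d) \<le> min 1 (e / max 1 (nm x))"
    using rat_closureE[OF assms(2), of "min 1 (e / max 1 (nm x))"] e
    by (auto simp: less_max_iff_disj)
  obtain c where c: "nm (x - of_rat c) \<le> e / B"
    using rat_closureE[OF assms(1), of "e / B"] e by (auto simp: B_def less_max_iff_disj)
  have "nm (y - of_rat d) \<le> B"
    using d by (simp add: B_def le_max_iff_disj)
  then have "nm (of_rat d) \<le> B"
    using nm_diff_le[of y B "y - of_rat d"] by (simp add: B_def)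
  then have "nm ((x - of_rat c) * of_rat d) \<le> e / B * B"
    unfolding nm_mult using c e by (intro mult_mono) (auto simp: B_def)
  then have 1: "nm ((x - of_rat c) * of_rat d) \<le> e"
    by (simp add: B_def)
  have "max 1 (nm x) > 0"
    by (simp add: less_max_iff_disj)
  have "nm (x * (y - of_rat d)) \<le> max 1 (nm x) * (e / max 1 (nm x))"
    unfolding nm_mult using d by (intro mult_mono) auto
  also have "\<dots> = e"
    using \<open>max 1 (nm x) > 0\<close> by simp
  finally have 2: "nm (x * (y - of_rat d)) \<le> e" .
  have "x * y - of_rat (c * d) = x * (y - of_rat d) + (x - of_rat c) * of_rat d"
    by (simp add: of_rat_mult algebra_simps)
  then show "\<exists>c. nm (x * y - of_rat c) \<le> e"
    using nm_add_le[OF 2 1] by metis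
qed

lemma rat_closure_inverse:
  assumes "x \<in> rat_closure"
  shows "inverse x \<in> rat_closure"
proof (cases "x = 0")
  case True
  then show ?thesis
    using of_rat_in_rat_closure[of 0] by simp
next
  case False
  show ?thesis
    unfolding rat_closure_def
  proof (intro CollectI allI impI)
    fix e :: real assume e: "e > 0"
    \<comment> \<open>The bound \<open>nm x / 2\<close> forces \<open>c\<close> to have the same
      norm as \<open>x\<close>; the other one compensates the denominator \<open>x * c\<close> of
      the difference of inverses.\<close>
    obtain c where c: "nm (x - of_rat c) \<le> min (nm x / 2) (e * (nm x * nm x))"
      using rat_closureE[OF assms, of "min (nm x / 2) (e * (nm x * nm x))"] e False by auto
    have "nm x > 0"
      using False by simp
    then have "nm (x - of_rat c) < nm x"
      using c by linarith
    then have nmc: "nm (of_rat c) = nm x"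
      using nm_add_eq[of "- (x - of_rat c)" x] by (metis diff_minus_eq_add minus_diff_eq nm_minus
          add.commute diff_add_cancel)
    then have "of_rat c \<noteq> (0 :: 'k)"
      using \<open>nm x > 0\<close> by auto
    then have "inverse x - of_rat (inverse c) = - ((x - of_rat c) / (x * of_rat c))"
      unfolding of_rat_inverse using False by (simp add: field_simps)
    then have "nm (inverse x - of_rat (inverse c)) = nm (x - of_rat c) / (nm x * nm x)"
      by (simp only: nm_minus nm_divide nm_mult nmc)
    also have "\<dots> \<le> e"
      using c \<open>nm x > 0\<close> by (simp add: pos_divide_le_eq)
    finally show "\<exists>c. nm (inverse x - of_rat c) \<le> e"
      by blast
  qed
qed

lemma rat_closure_limit:
  assumes "\<And>n. s n \<in> rat_closure" "(\<lambda>n. nm (s n - L)) \<longlonglongrightarrow> 0"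
  shows "L \<in> rat_closure"
  unfolding rat_closure_def
proof (intro CollectI allI impI)
  fix e :: real assume e: "e > 0"
  then have "eventually (\<lambda>n. nm (s n - L) < e) sequentially"
    using order_tendstoD(2)[OF assms(2)] by simp
  then obtain n where n: "nm (s n - L) < e"
    using eventually_happens'[OF sequentially_bot] by blast
  obtain c where "nm (s n - of_rat c) \<le> e"
    using assms(1)[of n] e unfolding rat_closure_def by blast
  then have "nm (L - of_rat c) \<le> e"
    using nm_triangle[of L "s n" e "of_rat c"] n by (simp add: nm_diff_commute)
  then show "\<exists>c. nm (L - of_rat c) \<le> e"
    by blast
qed

end

text \<open>Zero is a separate case because \<open>real_of_ereal\<close> sends \<infinity> to 0,
  which would give it norm 1.\<close>

definition val_norm :: "('k::field_char_0 \<Rightarrow> ereal) \<Rightarrow> 'k \<Rightarrow> real" where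
  "val_norm v x = (if x = 0 then 0 else exp (- real_of_ereal (v x)))"

definition val_radius :: "rat option \<Rightarrow> real" where
  "val_radius \<delta> = (case \<delta> of None \<Rightarrow> 0 | Some d \<Rightarrow> exp (- of_rat d))"

context
  fixes p :: nat and v :: "'k::field_char_0 \<Rightarrow> ereal"
  assumes prime: "prime p" and Cp: "is_Cp p v"
begin

lemma val_eq_infinity_iff: "v x = \<infinity> \<longleftrightarrow> x = 0"
  and val_finite: "v x \<noteq> - \<infinity>"
  and val_mult: "v (x * y) = v x + v y"
  and val_add: "v (x + y) \<ge> min (v x) (v y)"
  and val_rat: "c \<noteq> 0 \<Longrightarrow> v (of_rat c) = ereal (of_int (padic_val_rat p c))"
  and val_alg_closed: "degree P > 0 \<Longrightarrow> \<exists>x. poly P x = 0" for P :: "'k poly"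
  using Cp unfolding is_Cp_def by blast+

lemma val_real: "x \<noteq> 0 \<Longrightarrow> v x = ereal (real_of_ereal (v x))"
  using val_eq_infinity_iff[of x] val_finite[of x] by (cases "v x") auto

lemma val_norm_le_iff: "val_norm v x \<le> exp (- t) \<longleftrightarrow> v x \<ge> ereal t"
proof (cases "x = 0")
  case True
  then show ?thesis
    using val_eq_infinity_iff[of x] by (simp add: val_norm_def)
next
  case False
  have "v x \<ge> ereal t \<longleftrightarrow> real_of_ereal (v x) \<ge> t"
    by (subst val_real[OF False]) simp
  then show ?thesis
    using False by (simp add: val_norm_def)
qed

lemma val_norm_le: "e > 0 \<Longrightarrow> val_norm v x \<le> e \<longleftrightarrow> v x \<ge> ereal (- ln e)"
  using val_norm_le_iff[of x "- ln e"] by simp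

lemma nonarch_norm_val: "nonarch_norm (val_norm v)"
proof
  fix x y
  show "val_norm v x \<ge> 0" "val_norm v x = 0 \<longleftrightarrow> x = 0"
    by (simp_all add: val_norm_def)
  show "val_norm v (x * y) = val_norm v x * val_norm v y"
  proof (cases "x = 0 \<or> y = 0")
    case False
    then have "v (x * y) = ereal (real_of_ereal (v x) + real_of_ereal (v y))"
      using val_real[of x] val_real[of y] val_mult[of x y] by (metis plus_ereal.simps(1))
    then show ?thesis
      using False by (simp add: val_norm_def exp_add[symmetric])
  qed (auto simp: val_norm_def)
  show "val_norm v (x + y) \<le> max (val_norm v x) (val_norm v y)"
  proof (cases "x = 0 \<or> y = 0")
    case True
    then show ?thesis
      by auto
  next
    case False
    define t where "t = min (real_of_ereal (v x)) (real_of_ereal (v y))"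
    have "v x \<ge> ereal t" "v y \<ge> ereal t"
      using False val_real[of x] val_real[of y] by (metis ereal_less_eq(3) min.cobounded1 t_def,
          metis ereal_less_eq(3) min.cobounded2 t_def)
    then have "v (x + y) \<ge> ereal t"
      using val_add[of x y] by (meson min.boundedI order_trans)
    then have "val_norm v (x + y) \<le> exp (- t)"
      by (simp add: val_norm_le_iff)
    also have "\<dots> = max (val_norm v x) (val_norm v y)"
      using False by (simp add: val_norm_def t_def min_def max_def)
    finally show ?thesis .
  qed
qed

lemma Qp_in_eq: "Qp_in v = nonarch_norm.rat_closure (val_norm v)"
proof -
  interpret nonarch_norm "val_norm v"
    by (rule nonarch_norm_val)
  show ?thesis
    unfolding Qp_in_def rat_closure_def
  proof (intro Collect_cong iffI allI impI)
    fix x and e :: real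
    assume "\<forall>M. \<exists>r. ereal M \<le> v (x - of_rat r)" "e > 0"
    then show "\<exists>c. val_norm v (x - of_rat c) \<le> e"
      by (simp add: val_norm_le)
  next
    fix x M
    assume "\<forall>e>0. \<exists>c. val_norm v (x - of_rat c) \<le> e"
    then show "\<exists>r. ereal M \<le> v (x - of_rat r)"
      by (auto simp flip: val_norm_le_iff)
  qed
qed

lemma val_p: "v (of_nat p) = 1"
proof -
  have p: "p \<noteq> 0" "\<not> is_unit (int p)"
    using prime by (auto simp: prime_gt_0_nat not_prime_1)
  have "quotient_of (of_nat p) = (int p, 1)"
    by (simp add: of_nat_rat quotient_of_Fract normalize_def)
  moreover have "multiplicity (int p) (int p) = 1"
    using p by (intro multiplicity_self) auto
  ultimately have "padic_val_rat p (of_nat p) = 1"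
    by (simp add: padic_val_rat_def)
  then show ?thesis
    using val_rat[of "of_nat p"] p by (simp add: one_ereal_def)
qed

lemma padic_closed_field_val: "padic_closed_field (val_norm v) (Qp_in v) p"
proof -
  interpret nonarch_norm "val_norm v"
    by (rule nonarch_norm_val)
  show ?thesis
    unfolding Qp_in_eq
  proof
    show "\<exists>x. poly P x = 0" if "degree P > 0" for P :: "'k poly"
      by (rule val_alg_closed[OF that])
    show "1 \<in> rat_closure"
      using of_rat_in_rat_closure[of 1] by simp
    show "x - y \<in> rat_closure" "x * y \<in> rat_closure"
      if "x \<in> rat_closure" "y \<in> rat_closure" for x y
      using that by (auto intro: rat_closure_diff rat_closure_mult)
    show "inverse x \<in> rat_closure" if "x \<in> rat_closure" for x
      using that by (rule rat_closure_inverse)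
    show "of_rat c \<in> rat_closure" for c
      by (rule of_rat_in_rat_closure)
    show "\<exists>c. val_norm v (x - of_rat c) \<le> e" if "x \<in> rat_closure" "e > 0" for x e
      using that unfolding rat_closure_def by blast
    show "val_norm v (of_nat p) = exp (- 1)"
      using prime by (auto simp: val_norm_def val_p)
    show "\<exists>y P. P \<noteq> 0 \<and> poly (rat_to P) y = 0 \<and> val_norm v (x - y) \<le> e" if "e > 0" for x e
    proof -
      have "\<exists>y. (\<exists>P :: rat poly. P \<noteq> 0 \<and> poly (rat_to P) y = 0) \<and> v (x - y) \<ge> ereal (- ln e)"
        using Cp unfolding is_Cp_def by blast
      then show ?thesis
        using val_norm_le[OF that] by blast
    qed
    fix s :: "nat \<Rightarrow> 'k"
    assume s: "\<And>n. s n \<in> rat_closure"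
      and cauchy: "\<And>e. e > 0 \<Longrightarrow> \<exists>N. \<forall>m\<ge>N. \<forall>n\<ge>N. val_norm v (s m - s n) \<le> e"
    have "\<forall>M. \<exists>N. \<forall>m\<ge>N. \<forall>n\<ge>N. v (s m - s n) \<ge> ereal M"
      using cauchy[of "exp (- M)" for M] by (simp add: val_norm_le_iff)
    then obtain L where L: "\<forall>M. \<exists>N. \<forall>n\<ge>N. v (s n - L) \<ge> ereal M"
      using Cp unfolding is_Cp_def by blast
    have lim: "(\<lambda>n. val_norm v (s n - L)) \<longlonglongrightarrow> 0"
    proof (rule LIMSEQ_I)
      fix e :: real assume e: "e > 0"
      obtain N where "\<forall>n\<ge>N. v (s n - L) \<ge> ereal (- ln (e / 2))"
        using L by blast
      then have "\<forall>n\<ge>N. val_norm v (s n - L) \<le> e / 2"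
        using val_norm_le[of "e / 2"] e by simp
      then have "norm (val_norm v (s n - L) - 0) < e" if "n \<ge> N" for n
        using that e by fastforce
      then show "\<exists>N. \<forall>n\<ge>N. norm (val_norm v (s n - L) - 0) < e"
        by blast
    qed
    show "\<exists>L\<in>rat_closure. (\<lambda>n. val_norm v (s n - L)) \<longlonglongrightarrow> 0"
      using lim rat_closure_limit[OF s lim] by (intro bexI[of _ L])
  qed
qed

lemma closed_ball_iff: "x \<in> closed_ball_p v a \<delta> \<longleftrightarrow> val_norm v (x - a) \<le> val_radius \<delta>"
proof (cases \<delta>)
  case None
  have "val_norm v (x - a) \<le> 0 \<longleftrightarrow> x = a"
    by (simp add: val_norm_def not_le)
  then show ?thesis
    using None by (simp add: closed_ball_p_def val_radius_def)
next
  case (Some d)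
  then show ?thesis
    by (simp add: closed_ball_p_def val_radius_def val_norm_le_iff)
qed

text \<open>Expansion at \<open>a\<close> keeps the degree, so the minimum up to
  \<open>degree f\<close> sees every nonzero coefficient. Zero coefficients, with valuation
  \<infinity> and norm 0, satisfy both conditions.\<close>

lemma val_pol_iff:
  "val_pol v a \<delta> f \<ge> 0 \<longleftrightarrow> nonarch_norm.gauss_le (val_norm v) a (val_radius \<delta>) 1 (rat_to f)"
proof -
  interpret nonarch_norm "val_norm v"
    by (rule nonarch_norm_val)
  show ?thesis
  proof (cases \<delta>)
    case None
    then show ?thesis
      using val_norm_le_iff[of "poly (rat_to f) a" 0]
      by (simp add: val_pol_def val_radius_def gauss_le_0 zero_ereal_def)
  next
    case (Some d)
    let ?c = "coeff (pcompose (rat_to f) [:a, 1:])"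
    have coeff: "v (?c i) + ereal (of_rat d * of_nat i) \<ge> 0 \<longleftrightarrow>
        val_norm v (?c i) * exp (- of_rat d) ^ i \<le> 1" for i
    proof (cases "?c i = 0")
      case True
      then show ?thesis
        using val_eq_infinity_iff[of 0] by (simp add: val_norm_def)
    next
      case False
      have "v (?c i) + ereal (of_rat d * of_nat i) \<ge> 0 \<longleftrightarrow>
          real_of_ereal (v (?c i)) + of_rat d * of_nat i \<ge> 0"
        by (subst val_real[OF False]) (simp add: zero_ereal_def)
      moreover have "val_norm v (?c i) * exp (- of_rat d) ^ i =
          exp (- (real_of_ereal (v (?c i)) + of_rat d * of_nat i))"
        using False by (simp add: val_norm_def exp_add[symmetric] mult.commute
            flip: exp_of_nat_mult)
      ultimately show ?thesis
        by (simp only: exp_le_one_iff neg_le_0_iff_le)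
    qed
    have deg: "degree (pcompose (rat_to f) [:a, 1:]) = degree f"
      by (simp add: degree_pcompose)
    have "val_pol v a \<delta> f \<ge> 0 \<longleftrightarrow> (\<forall>i\<le>degree f. v (?c i) + ereal (of_rat d * of_nat i) \<ge> 0)"
      unfolding val_pol_def Some by (auto simp: Min_ge_iff)
    also have "\<dots> \<longleftrightarrow> (\<forall>i\<le>degree f. val_norm v (?c i) * exp (- of_rat d) ^ i \<le> 1)"
      by (simp add: coeff)
    also have "\<dots> \<longleftrightarrow> (\<forall>i. val_norm v (?c i) * exp (- of_rat d) ^ i \<le> 1)"
    proof (intro iffI allI impI)
      fix i assume le: "\<forall>i\<le>degree f. val_norm v (?c i) * exp (- of_rat d) ^ i \<le> 1"
      show "val_norm v (?c i) * exp (- of_rat d) ^ i \<le> 1"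
        using le deg by (cases "i \<le> degree f") (auto simp: coeff_eq_0)
    qed simp
    finally show ?thesis
      by (simp add: gauss_le_def val_radius_def Some)
  qed
qed

end

theorem mainTheorem11:
  fixes p :: nat and v :: "'k::field_char_0 \<Rightarrow> ereal" and m :: nat
    and \<alpha> :: "nat \<Rightarrow> 'k" and \<delta> :: "nat \<Rightarrow> rat option" and q :: "rat poly"
  assumes "prime p"
    and "is_Cp p v"
    and "\<forall>j<m. admissible v (\<alpha> j) (\<delta> j)"
    and "R = {f :: rat poly. \<forall>j<m. val_pol v (\<alpha> j) (\<delta> j) f \<ge> 0}"
    and "krull_domain R"
    and "irreducible q"
    and "Q = {f \<in> R. q dvd f}"
  shows "maximal_ideal_in R Q \<longleftrightarrow>
    \<not> (\<exists>x. poly (map_poly of_rat q) x = 0 \<and> (\<exists>j<m. x \<in> closed_ball_p v (\<alpha> j) (\<delta> j)))"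
proof -
  interpret padic_closed_field "val_norm v" "Qp_in v" p
    by (rule padic_closed_field_val[OF assms(1,2)])
  \<comment> \<open>A rational \<delta> gives a positive radius and a centre algebraic over
    \<open>Qp_in v\<close>, which is the subfield \<open>F\<close> here; \<delta> = \<infinity>
    gives radius 0.\<close>
  have adm: "val_radius (\<delta> j) > 0 \<and> (\<exists>h\<in>FX. h \<noteq> 0 \<and> poly h (\<alpha> j) = 0) \<or> val_radius (\<delta> j) = 0"
    if "j < m" for j
    using assms(3)[rule_format, OF that]
    by (auto simp: admissible_def val_radius_def Qp_bar_in_def FX_def split: option.splits)
  have R: "is_subring R"
    using assms(5) unfolding krull_domain_def by blast
  have R_eq: "R = {f. \<forall>j<m. gauss_le (\<alpha> j) (val_radius (\<delta> j)) 1 (rat_to f)}"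
    using assms(4) by (simp add: val_pol_iff[OF assms(1,2)])
  show ?thesis
    unfolding assms(7) closed_ball_iff[OF assms(1,2)]
    by (rule maximal_iff_no_root_in_discs[OF adm R_eq R assms(6)])
qed

end
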